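(* The set of L-divisible (qubit) Pauli channels is equal to the set of infinitely divisible (qubit) Pauli channels; that is, a Pauli channel is L-divisible if and only if it is infinitely divisible.
   Context: A qubit channel is a linear, completely positive, trace-preserving map on $\mathbb{C}^{2\times 2}$. A Pauli channel is a qubit channel of the form $\rho\mapsto\sum_{i=0}^{3}p_i\sigma_i\rho\sigma_i$ with $\sigma_0=\mathbb{1}$, $\sigma_1,\sigma_2,\sigma_3$ the Pauli matrices, $p_i\ge0$, $\sum_ip_i=1$. A channel $\mathcal{E}$ is infinitely divisible if for every positive integer $n$ there is a channel $\mathcal{E}_n$ with $\mathcal{E}=(\mathcal{E}_n)^n$ (here $\mathcal{E}_n$ is any qubit channel). A Lindblad generator is a linear map $L[\rho]=\mathrm{i}[\rho,H]+\sum_{i,j}G_{ij}\left(F_i\rho F_j^\dagger-\tfrac12\{F_j^\dagger F_i,\rho\}\right)$ with $H$, $G$ hermitian, $G\ge0$, and $F_i$ operators on the Hilbert space. A channel is L-divisible if it belongs to the closure of the set of non-singular channels $\mathcal{E}$ for which there is a Lindblad generator $L$ with $\mathcal{E}=e^{L}$. *)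

theory Defs
  imports "HOL-Analysis.Analysis"
begin

type_synonym superop = "(complex^2^2) \<Rightarrow>\<^sub>L (complex^2^2)"

definition cscale :: "complex \<Rightarrow> complex^'n^'m \<Rightarrow> complex^'n^'m" where
  "cscale c A = map_matrix ((*) c) A"

definition dagger :: "complex^'n^'m \<Rightarrow> complex^'m^'n" where
  "dagger A = map_matrix cnj (transpose A)"

definition psd_on :: "'i set \<Rightarrow> ('i \<Rightarrow> 'i \<Rightarrow> complex) \<Rightarrow> bool" where
  "psd_on I A \<longleftrightarrow> (\<forall>v. (\<Sum>i\<in>I. \<Sum>j\<in>I. cnj (v i) * A i j * v j) \<in> \<real>\<^sub>\<ge>\<^sub>0)"

text \<open>
  An \<open>n \<times> n\<close> family \<open>X\<close> of \<open>2 \<times> 2\<close> matrices stands for the operator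
  \<open>\<Sum>i j. |i><j| \<otimes> X i j\<close> on the tensor product of an \<open>n\<close>-level system with the qubit.
  In this encoding the extension of a map \<open>E\<close> by the identity on the \<open>n\<close>-level system
  is the blockwise application of \<open>E\<close>.
\<close>
definition block_psd :: "nat \<Rightarrow> (nat \<Rightarrow> nat \<Rightarrow> complex^2^2) \<Rightarrow> bool" where
  "block_psd n X \<longleftrightarrow> psd_on ({..<n} \<times> UNIV) (\<lambda>(i, a) (j, b). X i j $ a $ b)"

definition completely_positive :: "superop \<Rightarrow> bool" where
  "completely_positive E \<longleftrightarrow>
     (\<forall>n X. block_psd n X \<longrightarrow> block_psd n (\<lambda>i j. blinfun_apply E (X i j)))"

text \<open>
  The elements of \<^typ>\<open>superop\<close> are only real linear, so complex homogeneity is required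
  separately; boundedness is automatic in finite dimension.
\<close>
definition qubit_channel :: "superop \<Rightarrow> bool" where
  "qubit_channel E \<longleftrightarrow>
     (\<forall>c \<rho>. blinfun_apply E (cscale c \<rho>) = cscale c (blinfun_apply E \<rho>)) \<and>
     completely_positive E \<and>
     (\<forall>\<rho>. trace (blinfun_apply E \<rho>) = trace \<rho>)"

definition pauli :: "nat \<Rightarrow> complex^2^2" where
  "pauli i =
     [mat 1,
      vector [vector [0, 1], vector [1, 0]],
      vector [vector [0, -\<i>], vector [\<i>, 0]],
      vector [vector [1, 0], vector [0, -1]]] ! i"

definition pauli_channel :: "superop \<Rightarrow> bool" where
  "pauli_channel E \<longleftrightarrow> qubit_channel E \<and>
     (\<exists>p :: nat \<Rightarrow> real. (\<forall>i<4. p i \<ge> 0) \<and> (\<Sum>i<4. p i) = 1 \<and>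
        (\<forall>\<rho>. blinfun_apply E \<rho> = (\<Sum>i<4. p i *\<^sub>R (pauli i ** \<rho> ** pauli i))))"

definition infinitely_divisible :: "superop \<Rightarrow> bool" where
  "infinitely_divisible E \<longleftrightarrow> qubit_channel E \<and>
     (\<forall>n::nat. n > 0 \<longrightarrow>
        (\<exists>En. qubit_channel En \<and> blinfun_apply E = blinfun_apply En ^^ n))"

text \<open>
  The number \<open>m\<close> of operators \<open>F i\<close> is arbitrary, and they are subject to no
  independence, trace or normalization condition.
\<close>
definition lindblad_generator :: "superop \<Rightarrow> bool" where
  "lindblad_generator L \<longleftrightarrow>
     (\<exists>(H :: complex^2^2) (m :: nat) (G :: nat \<Rightarrow> nat \<Rightarrow> complex) (F :: nat \<Rightarrow> complex^2^2).
        dagger H = H \<and>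
        (\<forall>i<m. \<forall>j<m. G j i = cnj (G i j)) \<and>
        psd_on {..<m} G \<and>
        (\<forall>\<rho>. blinfun_apply L \<rho> =
           cscale \<i> (\<rho> ** H - H ** \<rho>) +
           (\<Sum>i<m. \<Sum>j<m. cscale (G i j)
              (F i ** \<rho> ** dagger (F j) -
               (1/2) *\<^sub>R (dagger (F j) ** F i ** \<rho> + \<rho> ** (dagger (F j) ** F i))))))"

text \<open>The exponential series, with composition as multiplication, in the operator norm.\<close>
definition superop_exp :: "superop \<Rightarrow> superop" where
  "superop_exp L = (\<Sum>n. (1 / fact n) *\<^sub>R ((\<lambda>X. L o\<^sub>L X) ^^ n) id_blinfun)"

text \<open>
  The closure is taken in the operator norm; all topologies given by a norm agree on this
  finite-dimensional space.
\<close>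
definition L_divisible :: "superop \<Rightarrow> bool" where
  "L_divisible E \<longleftrightarrow> qubit_channel E \<and>
     E \<in> closure {E'. qubit_channel E' \<and> bij (blinfun_apply E') \<and>
                      (\<exists>L. lindblad_generator L \<and> E' = superop_exp L)}"

end

(*
  A limit of exponentials of Lindblad generators is infinitely divisible because exp L is the n-th
  power of the channel exp (L/n), and because the channels form a compact set, so that the n-th
  powers of channels form a closed set. That exp L is completely positive follows from Euler's
  formula: writing L x = K x + x K* + Phi x with Phi completely positive, the map
  x |-> (1 + K/N) x (1 + K/N)* + (1/N) Phi x is completely positive and equals 1 + L/N + O(1/N^2).

  Conversely, let a Pauli channel with eigenvalues l_1, l_2, l_3 on the Pauli matrices be the n-th
  power of a channel with Bloch matrix T, which need not be diagonal. Two 2x2 minors of the Choi matrix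
  in the Bell basis bound the (i,j) block of T by 1 + T_kk and 1 - T_kk, hence its determinant, which
  is an n-th root of l_i l_j if l_k differs from l_i and l_j. For odd n it follows that the numbers
  r_i = |l_i|^(1/n) satisfy r_i + r_j <= 1 + r_k, so they are the eigenvalues of a Pauli channel P,
  and n (P - 1) is a Lindblad generator whose exponential has the eigenvalues exp (n (r_i - 1)),
  which tend to |l_i|. Square roots of the channel show that negative eigenvalues can only occur as
  a pair l_i = l_j < 0 <= l_k, and a rotation by the angle pi about the axis k supplies the signs.
*)

theory Submission
  imports Defs
begin

section \<open>The Banach algebra of bounded endomorphisms\<close>

text \<open>The obstacle is degeneracy. A root of a diagonal matrix with distinct entries commutes
  with it and is diagonal, but where two eigenvalues coincide the root may contain any 2x2 block
  with the right power, for instance a rotation, and it may shift the centre of the Bloch ball. What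
  can still be read off is multiplicative under powers: the diagonal entry of an isolated eigenvalue
  and the determinant of a degenerate block. Odd n makes \<open>T_kk\<close> inherit the sign of
  l_k. With \<open>T_kk\<close> nonnegative, 1 - \<open>T_kk\<close> is at most 1 +
  \<open>T_kk\<close>, so the two minors bound the determinant from both sides by the same quantity.
  If l_k equals l_i or l_j, the inequality for the r's holds because each of them is at most 1. No
  logarithm of the channel is taken: it fails for zero eigenvalues, and negative ones give it no
  real diagonal form. The generators n (P - 1) always exist, and a zero eigenvalue appears as the
  limit of exp (-n), which is where the closure enters. A single negative eigenvalue, or three equal
  ones, would be out of reach of the rotation; this is why the sign pattern has to be settled
  separately.\<close>

typedef (overloaded) ('a::real_normed_vector) endo = "UNIV :: ('a \<Rightarrow>\<^sub>L 'a) set"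
  by simp

setup_lifting type_definition_endo

text \<open>On this copy composition is multiplication, so that \<open>exp\<close>, powers and norm
  estimates for Banach algebras apply to superoperators. The sort \<open>perfect_space\<close>
  excludes the zero space, on which \<open>0 = 1\<close>.\<close>

instantiation endo :: ("{banach, perfect_space}") real_normed_algebra_1
begin

lift_definition zero_endo :: "'a endo" is 0 .
lift_definition one_endo :: "'a endo" is id_blinfun .
lift_definition plus_endo :: "'a endo \<Rightarrow> 'a endo \<Rightarrow> 'a endo" is "(+)" .
lift_definition minus_endo :: "'a endo \<Rightarrow> 'a endo \<Rightarrow> 'a endo" is "(-)" .
lift_definition uminus_endo :: "'a endo \<Rightarrow> 'a endo" is uminus .
lift_definition times_endo :: "'a endo \<Rightarrow> 'a endo \<Rightarrow> 'a endo" is "(o\<^sub>L)" .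
lift_definition scaleR_endo :: "real \<Rightarrow> 'a endo \<Rightarrow> 'a endo" is "(*\<^sub>R)" .
lift_definition norm_endo :: "'a endo \<Rightarrow> real" is norm .
lift_definition dist_endo :: "'a endo \<Rightarrow> 'a endo \<Rightarrow> real" is dist .
lift_definition sgn_endo :: "'a endo \<Rightarrow> 'a endo" is sgn .

definition uniformity_endo :: "('a endo \<times> 'a endo) filter"
  where "uniformity_endo = (INF e\<in>{0<..}. principal {(x, y). dist x y < e})"

definition open_endo :: "'a endo set \<Rightarrow> bool"
  where "open_endo U = (\<forall>x\<in>U. eventually (\<lambda>(x', y). x' = x \<longrightarrow> y \<in> U) uniformity)"

instance
proof
  fix a b c :: "'a endo" and r s :: real and U :: "'a endo set"
  show "a + b + c = a + (b + c)" by transfer (rule add.assoc)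
  show "a + b = b + a" by transfer (rule add.commute)
  show "0 + a = a" by transfer simp
  show "- a + a = 0" by transfer simp
  show "a - b = a + - b" by transfer simp
  show "r *\<^sub>R (a + b) = r *\<^sub>R a + r *\<^sub>R b" by transfer (rule scaleR_add_right)
  show "(r + s) *\<^sub>R a = r *\<^sub>R a + s *\<^sub>R a" by transfer (rule scaleR_add_left)
  show "r *\<^sub>R s *\<^sub>R a = (r * s) *\<^sub>R a" by transfer simp
  show "1 *\<^sub>R a = a" by transfer simp
  show "a * b * c = a * (b * c)" by transfer (simp add: blinfun_eqI)
  show "1 * a = a" by transfer (simp add: blinfun_eqI)
  show "a * 1 = a" by transfer (simp add: blinfun_eqI)
  show "(a + b) * c = a * c + b * c"
    by transfer (simp add: blinfun_eqI blinfun.bilinear_simps)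
  show "a * (b + c) = a * b + a * c"
    by transfer (simp add: blinfun_eqI blinfun.bilinear_simps)
  show "r *\<^sub>R a * b = r *\<^sub>R (a * b)"
    by transfer (simp add: blinfun_eqI blinfun.bilinear_simps)
  show "a * r *\<^sub>R b = r *\<^sub>R (a * b)"
    by transfer (simp add: blinfun_eqI blinfun.bilinear_simps)
  have "0 \<noteq> (id_blinfun :: 'a \<Rightarrow>\<^sub>L 'a)"
    using norm_blinfun_id[where 'a = 'a] by (metis norm_zero zero_neq_one)
  then show "(0::'a endo) \<noteq> 1" by transfer
  show "dist a b = norm (a - b)" by transfer (rule dist_norm)
  show "sgn a = inverse (norm a) *\<^sub>R a" by transfer (rule sgn_div_norm)
  show "(norm a = 0) = (a = 0)" by transfer simp
  show "norm (a + b) \<le> norm a + norm b" by transfer (rule norm_triangle_ineq)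
  show "norm (r *\<^sub>R a) = \<bar>r\<bar> * norm a" by transfer simp
  show "norm (a * b) \<le> norm a * norm b" by transfer (rule norm_blinfun_compose)
  show "norm (1::'a endo) = 1" by transfer simp
  show "open U = (\<forall>x\<in>U. eventually (\<lambda>(x', y). x' = x \<longrightarrow> y \<in> U) uniformity)"
    by (rule open_endo_def)
  show "uniformity = (INF e\<in>{0<..}. principal {(x :: 'a endo, y). dist x y < e})"
    by (rule uniformity_endo_def)
qed

end

instance endo :: ("{banach, perfect_space}") banach
proof
  fix X :: "nat \<Rightarrow> 'a endo"
  assume X: "Cauchy X"
  have "Cauchy (\<lambda>n. Rep_endo (X n))"
    using X unfolding Cauchy_def by transfer
  then obtain l where l: "(\<lambda>n. Rep_endo (X n)) \<longlonglongrightarrow> l"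
    using Cauchy_convergent_iff convergent_def by blast
  have "dist (X n) (Abs_endo l) = dist (Rep_endo (X n)) l" for n
    by (simp add: dist_endo.rep_eq Abs_endo_inverse)
  then have "X \<longlonglongrightarrow> Abs_endo l"
    using l by (simp add: tendsto_dist_iff[where f = X] tendsto_dist_iff[where f = "\<lambda>n. Rep_endo (X n)"])
  then show "convergent X" by (rule convergentI)
qed

lemma bounded_linear_Rep_endo: "bounded_linear Rep_endo"
  by (rule bounded_linear_intro[where K = 1])
    (simp_all add: plus_endo.rep_eq scaleR_endo.rep_eq norm_endo.rep_eq)

lemma funpow_compose_endo:
  "((\<lambda>X. L o\<^sub>L X) ^^ n) id_blinfun = Rep_endo (Abs_endo L ^ n)"
  by (induction n)
    (simp_all add: one_endo.rep_eq times_endo.rep_eq Abs_endo_inverse)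

lemma apply_power_endo: "blinfun_apply (Rep_endo (a ^ n)) = blinfun_apply (Rep_endo a) ^^ n"
  by (induction n) (auto simp: one_endo.rep_eq times_endo.rep_eq)

text \<open>\<open>Rep_endo\<close> is bounded and linear, hence passes through the exponential
  series term by term.\<close>

lemma superop_exp_eq_exp: "superop_exp L = Rep_endo (exp (Abs_endo L))"
proof -
  interpret bounded_linear Rep_endo by (rule bounded_linear_Rep_endo)
  show ?thesis
    unfolding superop_exp_def exp_def funpow_compose_endo
    by (simp add: suminf summable_exp_generic scaleR divide_inverse)
qed

lemma superop_exp_sums:
  "(\<lambda>n. ((\<lambda>X. L o\<^sub>L X) ^^ n) id_blinfun /\<^sub>R fact n) sums superop_exp L"
  using bounded_linear.sums[OF bounded_linear_Rep_endo exp_converges[of "Abs_endo L"]]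
  by (simp add: superop_exp_eq_exp funpow_compose_endo bounded_linear.linear linear_scale
      bounded_linear_Rep_endo)

lemma exp_scaleR_inverse_power:
  fixes x :: "'a::{real_normed_algebra_1, banach}"
  assumes "n > 0"
  shows "exp (x /\<^sub>R real n) ^ n = exp x"
proof -
  have "exp (real k *\<^sub>R y) = exp y ^ k" for k and y :: 'a
    by (induction k) (simp_all add: scaleR_add_left exp_add_commuting)
  from this[of n "x /\<^sub>R real n"] show ?thesis
    using assms by simp
qed

lemma superop_exp_power:
  assumes "n > 0"
  shows "blinfun_apply (superop_exp L) = blinfun_apply (superop_exp (L /\<^sub>R real n)) ^^ n"
proof -
  have "Abs_endo (L /\<^sub>R real n) = Abs_endo L /\<^sub>R real n"
    by (simp add: scaleR_endo.abs_eq eq_onp_def)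
  then show ?thesis
    using exp_scaleR_inverse_power[OF assms] by (metis superop_exp_eq_exp apply_power_endo)
qed

section \<open>Euler's limit formula with perturbed factors\<close>

lemma norm_exp_minus_affine_le:
  fixes x :: "'a::{real_normed_algebra_1, banach}"
  shows "norm (exp x - (1 + x)) \<le> (norm x)\<^sup>2 * exp (norm x)"
proof -
  \<comment> \<open>Without its first two terms the series is \<open>x^2\<close> times a series
    whose coefficients \<open>1 / fact (n + 2)\<close> are at most
    \<open>1 / fact n\<close>.\<close>
  have tail: "(\<lambda>n. x ^ (n + 2) /\<^sub>R fact (n + 2)) sums (exp x - (1 + x))"
    using sums_split_initial_segment[OF exp_converges, of 2 x]
    by (simp add: numeral_2_eq_2)
  have le: "norm (x ^ (n + 2) /\<^sub>R fact (n + 2)) \<le> (norm x)\<^sup>2 * (norm x ^ n /\<^sub>R fact n)" for n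
  proof -
    have "norm (x ^ (n + 2)) \<le> (norm x)\<^sup>2 * norm x ^ n"
      using norm_power_ineq[of x "n + 2"] by (simp only: power_add mult.commute)
    moreover have "inverse (fact (n + 2)) \<le> (inverse (fact n) :: real)"
      by (intro le_imp_inverse_le fact_mono) auto
    ultimately show ?thesis
      by (simp add: mult_mono mult.left_commute)
  qed
  have s: "(\<lambda>n. (norm x)\<^sup>2 * (norm x ^ n /\<^sub>R fact n)) sums ((norm x)\<^sup>2 * exp (norm x))"
    by (intro sums_mult exp_converges)
  have "norm (\<Sum>n. x ^ (n + 2) /\<^sub>R fact (n + 2)) \<le> (\<Sum>n. (norm x)\<^sup>2 * (norm x ^ n /\<^sub>R fact n))"
    using le s by (intro norm_suminf_le) (auto simp: sums_iff)
  then show ?thesis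
    using tail s by (simp add: sums_iff)
qed

text \<open>Telescoping without commutativity. Since \<open>1 \<le> M\<close>, the surplus powers of
  \<open>M\<close> can be rounded up to \<open>M ^ n\<close>.\<close>

lemma norm_power_diff_le:
  fixes a b :: "'a::real_normed_algebra_1"
  assumes "norm a \<le> M" "norm b \<le> M" "1 \<le> M"
  shows "norm (a ^ n - b ^ n) \<le> real n * M ^ n * norm (a - b)"
proof (induction n)
  case (Suc n)
  have "a ^ Suc n - b ^ Suc n = a * (a ^ n - b ^ n) + (a - b) * b ^ n"
    by (simp add: algebra_simps)
  then have "norm (a ^ Suc n - b ^ Suc n) \<le> norm a * norm (a ^ n - b ^ n) + norm (a - b) * norm (b ^ n)"
    by (metis norm_triangle_le add_mono norm_mult_ineq)
  also have "\<dots> \<le> M * (real n * M ^ n * norm (a - b)) + norm (a - b) * M ^ Suc n"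
  proof (intro add_mono mult_mono)
    have "norm (b ^ n) \<le> M ^ n"
      using norm_power_ineq[of b n] power_mono[OF assms(2), of n] by simp
    also have "M ^ n \<le> M ^ Suc n"
      using assms(3) by (intro power_increasing) auto
    finally show "norm (b ^ n) \<le> M ^ Suc n" .
  qed (use assms Suc in auto)
  finally show ?case
    by (simp add: algebra_simps)
qed simp

text \<open>Both \<open>T N\<close> and \<open>exp (x / N)\<close> equal \<open>1 + x / N\<close> up
  to an error of order \<open>1 / N^2\<close>. Taking N-th powers multiplies the error by N and a
  constant, which leaves order \<open>1 / N\<close>.\<close>

lemma euler_limit:
  fixes x :: "'a::{real_normed_algebra_1, banach}"
  assumes "\<And>N. N > 0 \<Longrightarrow> norm (T N - (1 + x /\<^sub>R real N)) \<le> C / (real N)\<^sup>2"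
  shows "(\<lambda>N. T N ^ N) \<longlonglongrightarrow> exp x"
proof -
  define K where "K = norm x + C"
  define B where "B = exp K * (C + (norm x)\<^sup>2 * exp (norm x))"
  have "C \<ge> 0"
    using order_trans[OF norm_ge_zero assms[of 1]] by simp
  have "norm (T N ^ N - exp x) \<le> B / real N" if "N > 0" for N
  proof -
    define y where "y = x /\<^sub>R real N"
    \<comment> \<open>A common bound for \<open>T N\<close> and \<open>exp y\<close> whose N-th
      power \<open>exp K\<close> does not depend on \<open>N\<close>.\<close>
    define M where "M = exp (K / real N)"
    have y: "norm y = norm x / real N"
      by (simp add: y_def divide_inverse mult.commute)
    have "norm y \<le> norm x"
      using that divide_left_mono[of 1 "real N" "norm x"] by (simp add: y)
    have MN: "M ^ N = exp K"
      using that by (simp add: M_def exp_of_nat_mult[symmetric])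
    have "norm (T N) \<le> norm (1 + y) + C / (real N)\<^sup>2"
      using assms[OF that] norm_triangle_sub[of "T N" "1 + y"] by (simp add: y_def)
    also have "\<dots> \<le> (1 + norm y) + C / real N"
      using that \<open>C \<ge> 0\<close> norm_triangle_ineq[of 1 y]
      by (intro add_mono) (auto simp: power2_eq_square divide_simps mult_le_cancel_left1)
    also have "\<dots> = 1 + K / real N"
      by (simp add: y K_def add_divide_distrib)
    also have "\<dots> \<le> M"
      unfolding M_def by (rule exp_ge_add_one_self)
    finally have T: "norm (T N) \<le> M" .
    have e: "norm (exp y) \<le> M"
      using \<open>C \<ge> 0\<close> order_trans[OF norm_exp[of y], of M]
      by (simp add: M_def K_def y divide_right_mono)
    have "1 \<le> M"
      using \<open>C \<ge> 0\<close> by (simp add: M_def K_def)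
    have "norm (exp y - (1 + y)) \<le> (norm y)\<^sup>2 * exp (norm y)"
      by (rule norm_exp_minus_affine_le)
    also have "\<dots> \<le> (norm y)\<^sup>2 * exp (norm x)"
      using \<open>norm y \<le> norm x\<close> by (intro mult_left_mono) auto
    finally have "norm (T N - exp y) \<le> C / (real N)\<^sup>2 + (norm y)\<^sup>2 * exp (norm x)"
      using assms[OF that] norm_triangle_ineq4[of "T N - (1 + y)" "exp y - (1 + y)"]
      by (simp add: y_def)
    also have "\<dots> = (C + (norm x)\<^sup>2 * exp (norm x)) / (real N)\<^sup>2"
      by (simp add: y power_divide add_divide_distrib)
    finally have d: "norm (T N - exp y) \<le> (C + (norm x)\<^sup>2 * exp (norm x)) / (real N)\<^sup>2" .
    have "exp x = exp y ^ N"
      using that by (simp add: y_def exp_scaleR_inverse_power)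
    then have "norm (T N ^ N - exp x) \<le> real N * exp K * norm (T N - exp y)"
      using norm_power_diff_le[OF T e \<open>1 \<le> M\<close>, of N] by (simp add: MN)
    also have "\<dots> \<le> real N * exp K * ((C + (norm x)\<^sup>2 * exp (norm x)) / (real N)\<^sup>2)"
      by (intro mult_left_mono d) auto
    also have "\<dots> = B / real N"
      using that by (simp add: B_def power2_eq_square)
    finally show ?thesis .
  qed
  then have "eventually (\<lambda>N. norm (T N ^ N - exp x) \<le> B / real N) sequentially"
    by (rule eventually_mono[OF eventually_gt_at_top[of 0]])
  then have "(\<lambda>N. T N ^ N - exp x) \<longlonglongrightarrow> 0"
    by (rule Lim_null_comparison) (rule lim_const_over_n)
  then show ?thesis
    by (rule LIM_zero_cancel)
qed

section \<open>Positive semidefinite matrices\<close>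

text \<open>Hermitian symmetry is not assumed: the values at (1, 1) and (1, i) have to be real,
  which forces \<open>c = cnj b\<close>. The determinant bound comes from minimizing the
  form.\<close>

lemma psd_two_form:
  fixes a b c d :: complex
  assumes "\<And>x y. cnj x * a * x + cnj x * b * y + cnj y * c * x + cnj y * d * y \<in> \<real>\<^sub>\<ge>\<^sub>0"
  shows "a \<in> \<real>\<^sub>\<ge>\<^sub>0" "d \<in> \<real>\<^sub>\<ge>\<^sub>0" "c = cnj b" "(cmod b)\<^sup>2 \<le> Re a * Re d"
proof -
  show a: "a \<in> \<real>\<^sub>\<ge>\<^sub>0" using assms[of 1 0] by simp
  show d: "d \<in> \<real>\<^sub>\<ge>\<^sub>0" using assms[of 0 1] by simp
  show c: "c = cnj b"
    using assms[of 1 1] assms[of 1 \<i>] a d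
    by (simp add: complex_nonneg_Reals_iff complex_eq_iff)
  have ad: "a = of_real (Re a)" "d = of_real (Re d)" "Re a \<ge> 0" "Re d \<ge> 0"
    using a d by (auto simp: complex_nonneg_Reals_iff complex_eq_iff)
  have form: "Re a * (cmod x)\<^sup>2 + 2 * Re (cnj x * b * y) + Re d * (cmod y)\<^sup>2 \<ge> 0" for x y
  proof -
    have "Re (cnj x * a * x + cnj x * b * y + cnj y * c * x + cnj y * d * y)
        = Re a * (cmod x)\<^sup>2 + 2 * Re (cnj x * b * y) + Re d * (cmod y)\<^sup>2"
      using a d cmod_power2[of x] cmod_power2[of y]
      by (simp add: c complex_nonneg_Reals_iff power2_eq_square algebra_simps)
    moreover have "Re (cnj x * a * x + cnj x * b * y + cnj y * c * x + cnj y * d * y) \<ge> 0"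
      using assms[of x y] by (simp only: complex_nonneg_Reals_iff)
    ultimately show ?thesis by linarith
  qed
  show "(cmod b)\<^sup>2 \<le> Re a * Re d"
  proof (cases "Re a = 0")
    case False
    \<comment> \<open>The vector \<open>(- b, a)\<close> is a multiple of the minimizer of the form
      at fixed second coordinate; the value there is \<open>a\<close> times the determinant.\<close>
    have "Re a * (cmod b)\<^sup>2 - 2 * ((cmod b)\<^sup>2 * Re a) + Re d * (Re a)\<^sup>2 \<ge> 0"
    proof -
      have "Re (cnj (- b) * b * of_real (Re a)) = - ((cmod b)\<^sup>2 * Re a)"
        unfolding cmod_power2 by (simp add: power2_eq_square algebra_simps)
      then show ?thesis
        using form[of "- b" "of_real (Re a)"]
        by (simp only: norm_minus_cancel norm_of_real power2_abs)
    qed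
    then have "Re a * (Re a * Re d - (cmod b)\<^sup>2) \<ge> 0"
      by (simp add: algebra_simps power2_eq_square)
    then show ?thesis
      using False ad by (simp add: zero_le_mult_iff)
  next
    case True
    have "b = 0"
    proof (rule ccontr)
      assume "b \<noteq> 0"
      \<comment> \<open>With \<open>a = 0\<close> the form is affine along multiples of
        \<open>b\<close>. This \<open>t\<close> makes its value \<open>- Re d - 2\<close>, which is
        negative.\<close>
      define t where "t = (Re d + 1) / (cmod b)\<^sup>2"
      have "Re (cnj (of_real (- t) * b) * b * 1) = - t * (cmod b)\<^sup>2"
        unfolding cmod_power2 by (simp add: power2_eq_square algebra_simps)
      also have "\<dots> = - (Re d + 1)"
        using \<open>b \<noteq> 0\<close> by (simp add: t_def)
      finally show False
        using form[of "of_real (- t) * b" 1] True ad by simp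
    qed
    then show ?thesis using ad by simp
  qed
qed

lemma psd_on_pair:
  assumes "finite I" "psd_on I A" "i \<in> I" "j \<in> I" "i \<noteq> j"
  shows "cnj x * A i i * x + cnj x * A i j * y + cnj y * A j i * x + cnj y * A j j * y \<in> \<real>\<^sub>\<ge>\<^sub>0"
proof -
  define v where "v k = (if k = i then x else if k = j then y else 0)" for k
  have restrict: "(\<Sum>k\<in>I. f k) = f i + f j" if "\<And>k. k \<noteq> i \<Longrightarrow> k \<noteq> j \<Longrightarrow> f k = 0" for f :: "_ \<Rightarrow> complex"
  proof -
    have "(\<Sum>k\<in>I. f k) = (\<Sum>k\<in>{i, j}. f k)"
      using assms that by (intro sum.mono_neutral_right) auto
    then show ?thesis using assms by simp
  qed
  have psd: "(\<Sum>k\<in>I. \<Sum>l\<in>I. cnj (v k) * A k l * v l) \<in> \<real>\<^sub>\<ge>\<^sub>0"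
    using assms(2) unfolding psd_on_def by blast
  have "(\<Sum>k\<in>I. \<Sum>l\<in>I. cnj (v k) * A k l * v l)
      = (\<Sum>k\<in>I. cnj (v k) * A k i * v i + cnj (v k) * A k j * v j)"
    by (intro sum.cong refl restrict) (auto simp: v_def)
  also have "\<dots> = cnj (v i) * A i i * v i + cnj (v i) * A i j * v j
      + (cnj (v j) * A j i * v i + cnj (v j) * A j j * v j)"
    by (intro restrict) (auto simp: v_def)
  finally show ?thesis
    using psd assms(5) by (simp add: v_def add.assoc)
qed

lemma psd_on_diag:
  assumes "finite I" "psd_on I A" "i \<in> I"
  shows "A i i \<in> \<real>\<^sub>\<ge>\<^sub>0"
proof -
  define v where "v k = (if k = i then 1 else 0 :: complex)" for k
  have restrict: "(\<Sum>k\<in>I. f k) = f i" if "\<And>k. k \<noteq> i \<Longrightarrow> f k = 0" for f :: "_ \<Rightarrow> complex"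
  proof -
    have "(\<Sum>k\<in>I. f k) = (\<Sum>k\<in>{i}. f k)"
      using assms that by (intro sum.mono_neutral_right) auto
    then show ?thesis by simp
  qed
  have psd: "(\<Sum>k\<in>I. \<Sum>l\<in>I. cnj (v k) * A k l * v l) \<in> \<real>\<^sub>\<ge>\<^sub>0"
    using assms(2) unfolding psd_on_def by blast
  have "(\<Sum>k\<in>I. \<Sum>l\<in>I. cnj (v k) * A k l * v l) = (\<Sum>k\<in>I. cnj (v k) * A k i * v i)"
    by (intro sum.cong refl restrict) (auto simp: v_def)
  also have "\<dots> = cnj (v i) * A i i * v i"
    by (intro restrict) (auto simp: v_def)
  finally show ?thesis
    using psd by (simp add: v_def)
qed

lemma psd_on_hermitian:
  assumes "finite I" "psd_on I A" "i \<in> I" "j \<in> I"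
  shows "A j i = cnj (A i j)"
proof (cases "i = j")
  case True
  then show ?thesis
    using psd_on_diag[OF assms(1-3)] by (simp add: complex_nonneg_Reals_iff complex_eq_iff)
next
  case False
  from psd_two_form(3)[OF psd_on_pair[OF assms False]] show ?thesis .
qed

lemma psd_on_minor:
  assumes "finite I" "psd_on I A" "i \<in> I" "j \<in> I"
  shows "(cmod (A i j))\<^sup>2 \<le> Re (A i i) * Re (A j j)"
proof (cases "i = j")
  case True
  then show ?thesis
    using psd_on_diag[OF assms(1-3)]
    by (simp add: complex_nonneg_Reals_iff cmod_power2) (simp add: power2_eq_square)
next
  case False
  from psd_two_form(4)[OF psd_on_pair[OF assms False]] show ?thesis .
qed

lemma psd_on_insertD:
  assumes "finite I" "k \<notin> I" "psd_on (insert k I) A"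
  shows "psd_on I A"
  unfolding psd_on_def
proof
  fix v :: "_ \<Rightarrow> complex"
  let ?w = "v(k := 0)"
  have psd: "(\<Sum>i\<in>insert k I. \<Sum>j\<in>insert k I. cnj (?w i) * A i j * ?w j) \<in> \<real>\<^sub>\<ge>\<^sub>0"
    using assms(3) unfolding psd_on_def by blast
  have "(\<Sum>i\<in>insert k I. \<Sum>j\<in>insert k I. cnj (?w i) * A i j * ?w j)
      = (\<Sum>i\<in>I. \<Sum>j\<in>I. cnj (?w i) * A i j * ?w j)"
    using assms by simp
  also have "\<dots> = (\<Sum>i\<in>I. \<Sum>j\<in>I. cnj (v i) * A i j * v j)"
    using assms by (intro sum.cong refl) auto
  finally show "(\<Sum>i\<in>I. \<Sum>j\<in>I. cnj (v i) * A i j * v j) \<in> \<real>\<^sub>\<ge>\<^sub>0"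
    using psd by simp
qed

text \<open>Minimizing the form of \<open>A\<close> over the coordinate \<open>k\<close> leaves
  exactly the form of the Schur complement in the other coordinates.\<close>

lemma psd_on_Schur_complement:
  assumes I: "finite I" "k \<notin> I" and A: "psd_on (insert k I) A" and g: "A k k \<noteq> 0"
  shows "psd_on I (\<lambda>i j. A i j - A i k * A k j / A k k)"
  unfolding psd_on_def
proof
  fix v :: "_ \<Rightarrow> complex"
  define s where "s = (\<Sum>j\<in>I. A k j * v j)"
  \<comment> \<open>The minimizing value of coordinate \<open>k\<close> when the others are given by
    \<open>v\<close>.\<close>
  define w where "w = v(k := - s / A k k)"
  have psd: "(\<Sum>i\<in>insert k I. \<Sum>j\<in>insert k I. cnj (w i) * A i j * w j) \<in> \<real>\<^sub>\<ge>\<^sub>0"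
    using A unfolding psd_on_def by blast
  have w: "w i = v i" if "i \<in> I" for i
    using that I by (auto simp: w_def)
  have real: "cnj (A k k) = A k k"
    using psd_on_hermitian[OF _ A, of k k] I by simp
  have col: "A i k = cnj (A k i)" if "i \<in> I" for i
    using psd_on_hermitian[OF _ A, of k i] I that by simp
  have s': "(\<Sum>i\<in>I. cnj (v i) * A i k) = cnj s"
    by (simp add: s_def cnj_sum col mult.commute)
  have "(\<Sum>i\<in>insert k I. \<Sum>j\<in>insert k I. cnj (w i) * A i j * w j)
      = cnj (w k) * A k k * w k + (\<Sum>j\<in>I. cnj (w k) * A k j * v j)
        + ((\<Sum>i\<in>I. cnj (v i) * A i k * w k) + (\<Sum>i\<in>I. \<Sum>j\<in>I. cnj (v i) * A i j * v j))"
    using I by (simp add: w sum.distrib cong: sum.cong)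
  also have "(\<Sum>j\<in>I. cnj (w k) * A k j * v j) = cnj (w k) * s"
    by (simp add: s_def sum_distrib_left mult.assoc)
  also have "(\<Sum>i\<in>I. cnj (v i) * A i k * w k) = cnj s * w k"
    by (simp add: s'[symmetric] sum_distrib_right)
  also have "cnj (w k) * A k k * w k + cnj (w k) * s
      + (cnj s * w k + (\<Sum>i\<in>I. \<Sum>j\<in>I. cnj (v i) * A i j * v j))
      = (\<Sum>i\<in>I. \<Sum>j\<in>I. cnj (v i) * A i j * v j) - cnj s * s / A k k"
    using g by (simp add: w_def real field_simps)
  also have "cnj s * s / A k k = (\<Sum>i\<in>I. \<Sum>j\<in>I. cnj (v i) * (A i k * A k j / A k k) * v j)"
    by (subst s'[symmetric], simp add: s_def sum_product sum_divide_distrib mult_ac) (rule sum.swap)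
  finally show "(\<Sum>i\<in>I. \<Sum>j\<in>I. cnj (v i) * (A i j - A i k * A k j / A k k) * v j) \<in> \<real>\<^sub>\<ge>\<^sub>0"
    using psd by (simp add: left_diff_distrib right_diff_distrib sum_subtractf)
qed

text \<open>A consequence of the Schur product theorem, obtained without diagonalizing: a rank-one
  matrix built from row and column \<open>k\<close> is split off from \<open>A\<close>. Its
  contribution is a value of the form of \<open>B\<close>, and the rest is a Schur complement on a
  smaller index set.\<close>

lemma psd_on_sum_mult:
  assumes "finite I" "psd_on I A" "psd_on I B"
  shows "(\<Sum>i\<in>I. \<Sum>j\<in>I. A i j * B i j) \<in> \<real>\<^sub>\<ge>\<^sub>0"
  using assms
proof (induction I arbitrary: A rule: finite_induct)
  case empty
  then show ?case by simp
next
  case (insert k I)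
  note A = \<open>psd_on (insert k I) A\<close> and B = \<open>psd_on (insert k I) B\<close>
  have fin: "finite (insert k I)" using insert by simp
  have BI: "psd_on I B" by (rule psd_on_insertD[OF insert.hyps B])
  show ?case
  proof (cases "A k k = 0")
    case True
    \<comment> \<open>A vanishing diagonal entry kills its row and column, by the 2x2
      minors.\<close>
    have row: "A k j = 0" "A j k = 0" if "j \<in> I" for j
      using psd_on_minor[OF fin A, of k j] psd_on_minor[OF fin A, of j k] True that by auto
    have "(\<Sum>i\<in>insert k I. \<Sum>j\<in>insert k I. A i j * B i j) = (\<Sum>i\<in>I. \<Sum>j\<in>I. A i j * B i j)"
      using insert.hyps True row by (simp add: sum.distrib)
    then show ?thesis
      using insert.IH[OF psd_on_insertD[OF insert.hyps A] BI] by simp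
  next
    case False
    \<comment> \<open>Row and column \<open>k\<close> of \<open>C\<close> vanish. By Hermitian
      symmetry \<open>A - C\<close> has the entries \<open>cnj (A k i) * A k j / A k k\<close>, so
      summing it against \<open>B\<close> evaluates the form of \<open>B\<close> at row
      \<open>k\<close> of \<open>A\<close>.\<close>
    define C where "C i j = A i j - A i k * A k j / A k k" for i j
    have g: "A k k \<in> \<real>\<^sub>\<ge>\<^sub>0"
      by (rule psd_on_diag[OF fin A]) simp
    have "(\<Sum>i\<in>I. \<Sum>j\<in>I. C i j * B i j) \<in> \<real>\<^sub>\<ge>\<^sub>0"
      unfolding C_def by (rule insert.IH[OF psd_on_Schur_complement[OF insert.hyps A False] BI])
    moreover have "(\<Sum>i\<in>insert k I. \<Sum>j\<in>insert k I. C i j * B i j) = (\<Sum>i\<in>I. \<Sum>j\<in>I. C i j * B i j)"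
    proof -
      have "C k j = 0" "C j k = 0" for j
        using False by (auto simp: C_def)
      then show ?thesis
        using insert.hyps by (simp add: sum.distrib)
    qed
    moreover have "(\<Sum>i\<in>insert k I. \<Sum>j\<in>insert k I. cnj (A k i) * B i j * A k j) / A k k \<in> \<real>\<^sub>\<ge>\<^sub>0"
      using B unfolding psd_on_def by (intro nonneg_Reals_divide_I g) blast
    moreover have "(\<Sum>i\<in>insert k I. \<Sum>j\<in>insert k I. A i j * B i j)
        = (\<Sum>i\<in>insert k I. \<Sum>j\<in>insert k I. C i j * B i j)
          + (\<Sum>i\<in>insert k I. \<Sum>j\<in>insert k I. cnj (A k i) * B i j * A k j) / A k k"
      unfolding sum_divide_distrib sum.distrib[symmetric]
    proof (intro sum.cong refl)
      fix i j assume "i \<in> insert k I" "j \<in> insert k I"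
      then have "cnj (A k i) = A i k"
        using psd_on_hermitian[OF fin A, of k i] by simp
      then show "A i j * B i j = C i j * B i j + cnj (A k i) * B i j * A k j / A k k"
        by (simp add: C_def algebra_simps)
    qed
    ultimately show ?thesis
      by (simp add: nonneg_Reals_add_I)
  qed
qed

section \<open>Operators on the qubit\<close>

lemma cscale_nth [simp]: "cscale c A $ i $ j = c * A $ i $ j"
  by (simp add: cscale_def map_matrix_def)

lemma dagger_nth [simp]: "dagger A $ i $ j = cnj (A $ j $ i)"
  by (simp add: dagger_def map_matrix_def transpose_def)

lemma matrix_mult_nth_2: "(A ** B) $ i $ j = A $ i $ 1 * B $ 1 $ j + A $ i $ 2 * B $ 2 $ j"
  for A :: "complex^2^'n" and B :: "complex^'m^2"
  by (simp add: matrix_matrix_mult_def sum_2)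

lemma trace_2: "trace A = A $ 1 $ 1 + A $ 2 $ 2" for A :: "complex^2^2"
  by (simp add: trace_def sum_2)

lemma qubit_eq_iff:
  "A = B \<longleftrightarrow> A $ 1 $ 1 = B $ 1 $ 1 \<and> A $ 1 $ 2 = B $ 1 $ 2 \<and> A $ 2 $ 1 = B $ 2 $ 1 \<and> A $ 2 $ 2 = B $ 2 $ 2"
  for A B :: "complex^2^2"
  by (auto simp: vec_eq_iff forall_2)

lemma bounded_linear_cscale: "bounded_linear (cscale c :: complex^2^2 \<Rightarrow> complex^2^2)"
  by (intro linear_conv_bounded_linear[THEN iffD1] linearI)
    (simp_all add: qubit_eq_iff algebra_simps)

lemma bounded_linear_cscale_left: "bounded_linear (\<lambda>c. cscale c (A :: complex^2^2))"
  by (intro linear_conv_bounded_linear[THEN iffD1] linearI)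
    (simp_all add: qubit_eq_iff algebra_simps)

lemma bounded_linear_trace: "bounded_linear (trace :: complex^2^2 \<Rightarrow> complex)"
  by (intro linear_conv_bounded_linear[THEN iffD1] linearI)
    (simp_all add: trace_2 algebra_simps)

definition sandwich :: "complex^2^2 \<Rightarrow> complex^2^2 \<Rightarrow> superop" where
  "sandwich A B = Blinfun (\<lambda>\<rho>. A ** \<rho> ** B)"

lemma sandwich_apply [simp]: "blinfun_apply (sandwich A B) \<rho> = A ** \<rho> ** B"
proof -
  have "bounded_linear (\<lambda>\<rho>. A ** \<rho> ** B)"
    by (intro linear_conv_bounded_linear[THEN iffD1] linearI)
      (simp_all add: qubit_eq_iff matrix_mult_nth_2 algebra_simps)
  then show ?thesis
    by (simp add: sandwich_def bounded_linear_Blinfun_apply)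
qed

definition sesq :: "complex^2 \<Rightarrow> complex^2^2 \<Rightarrow> complex^2 \<Rightarrow> complex" where
  "sesq u A w = (\<Sum>a\<in>UNIV. \<Sum>b\<in>UNIV. cnj (u $ a) * A $ a $ b * w $ b)"

text \<open>A vector of the product space is cut into \<open>n\<close> qubit vectors, one for each
  block index.\<close>

lemma block_psd_iff:
  "block_psd n X \<longleftrightarrow> (\<forall>v :: nat \<Rightarrow> complex^2. (\<Sum>i<n. \<Sum>j<n. sesq (v i) (X i j) (v j)) \<in> \<real>\<^sub>\<ge>\<^sub>0)"
proof -
  have eq: "(\<Sum>p\<in>{..<n} \<times> UNIV. \<Sum>q\<in>{..<n} \<times> UNIV.
      cnj (v p) * (case (p, q) of ((i, a), (j, b)) \<Rightarrow> X i j $ a $ b) * v q)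
    = (\<Sum>i<n. \<Sum>j<n. sesq (\<chi> a. v (i, a)) (X i j) (\<chi> b. v (j, b)))" (is "?L v = ?R v")
    for v :: "nat \<times> 2 \<Rightarrow> complex"
  proof -
    have "?L v = (\<Sum>i<n. \<Sum>a\<in>UNIV. \<Sum>j<n. \<Sum>b\<in>UNIV. cnj (v (i, a)) * X i j $ a $ b * v (j, b))"
      by (simp add: sum.cartesian_product')
    also have "\<dots> = ?R v"
      unfolding sesq_def by (subst (2) sum.swap) simp
    finally show ?thesis .
  qed
  show ?thesis
  proof
    assume psd: "block_psd n X"
    show "\<forall>v :: nat \<Rightarrow> complex^2. (\<Sum>i<n. \<Sum>j<n. sesq (v i) (X i j) (v j)) \<in> \<real>\<^sub>\<ge>\<^sub>0"
    proof
      fix v :: "nat \<Rightarrow> complex^2"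
      show "(\<Sum>i<n. \<Sum>j<n. sesq (v i) (X i j) (v j)) \<in> \<real>\<^sub>\<ge>\<^sub>0"
        using psd[unfolded block_psd_def psd_on_def, rule_format, of "\<lambda>(i, a). v i $ a"]
          eq[of "\<lambda>(i, a). v i $ a"] by (simp add: case_prod_unfold)
    qed
  next
    assume "\<forall>v :: nat \<Rightarrow> complex^2. (\<Sum>i<n. \<Sum>j<n. sesq (v i) (X i j) (v j)) \<in> \<real>\<^sub>\<ge>\<^sub>0"
    then show "block_psd n X"
      unfolding block_psd_def psd_on_def using eq by (simp add: case_prod_unfold)
  qed
qed

lemma sesq_add: "sesq u (A + B) w = sesq u A w + sesq u B w"
  by (simp add: sesq_def sum_2 algebra_simps)

lemma sesq_scaleR: "sesq u (r *\<^sub>R A) w = of_real r * sesq u A w"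
  by (simp add: sesq_def sum_2) (simp add: scaleR_conv_of_real algebra_simps)

lemma sesq_sandwich: "sesq u (A ** X ** dagger B) w = sesq (dagger A *v u) X (dagger B *v w)"
  by (simp add: sesq_def sum_2 matrix_mult_nth_2 matrix_vector_mult_def algebra_simps)

lemma sesq_cscale: "sesq u (cscale c A) w = c * sesq u A w"
  by (simp add: sesq_def sum_2 algebra_simps)

lemma sesq_sum: "sesq u (\<Sum>i\<in>I. A i) w = (\<Sum>i\<in>I. sesq u (A i) w)"
  by (induction I rule: infinite_finite_induct) (simp_all add: sesq_add, simp_all add: sesq_def)

lemma sesq_sum_left: "sesq (\<Sum>i\<in>I. u i) A w = (\<Sum>i\<in>I. sesq (u i) A w)"
  by (simp add: sesq_def sum_2 cnj_sum sum_distrib_right sum.distrib)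

lemma sesq_sum_right: "sesq u A (\<Sum>i\<in>I. w i) = (\<Sum>i\<in>I. sesq u A (w i))"
  by (simp add: sesq_def sum_2 sum_distrib_left sum.distrib)

lemma sesq_mult: "sesq (c *s u) A (d *s w) = cnj c * sesq u A w * d"
  by (simp add: sesq_def sum_2 algebra_simps)

lemma continuous_sesq: "continuous_on UNIV (\<lambda>X. sesq u X w)"
  unfolding sesq_def by (intro continuous_intros)

section \<open>Completely positive maps\<close>

lemma completely_positive_id: "completely_positive id_blinfun"
  by (simp add: completely_positive_def)

lemma completely_positive_compose:
  "completely_positive E \<Longrightarrow> completely_positive F \<Longrightarrow> completely_positive (E o\<^sub>L F)"
  by (simp add: completely_positive_def)

lemma completely_positive_add:
  "completely_positive E \<Longrightarrow> completely_positive F \<Longrightarrow> completely_positive (E + F)"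
  by (simp add: completely_positive_def block_psd_iff blinfun.add_left sesq_add sum.distrib
      nonneg_Reals_add_I)

lemma completely_positive_scaleR:
  "r \<ge> 0 \<Longrightarrow> completely_positive E \<Longrightarrow> completely_positive (r *\<^sub>R E)"
  by (simp add: completely_positive_def block_psd_iff blinfun.scaleR_left sesq_scaleR
      nonneg_Reals_mult_I flip: sum_distrib_left)

lemma completely_positive_sandwich: "completely_positive (sandwich A (dagger A))"
  by (simp add: completely_positive_def block_psd_iff sesq_sandwich)

text \<open>For block vectors \<open>v\<close> the form of the image is the sum of
  \<open>G i j * Y i j\<close>, where \<open>Y\<close> collects the values of the form of
  \<open>X\<close> at the vectors moved by \<open>dagger (F i)\<close>. Both factors are positive
  semidefinite, so \<open>psd_on_sum_mult\<close> applies and \<open>G\<close> need not be brought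
  to diagonal form.\<close>

lemma completely_positive_sandwich_sum:
  fixes G :: "nat \<Rightarrow> nat \<Rightarrow> complex"
  assumes G: "psd_on {..<m} G"
  shows "completely_positive (\<Sum>i<m. \<Sum>j<m. sandwich (cscale (G i j) (F i)) (dagger (F j)))"
  unfolding completely_positive_def
proof (intro allI impI)
  fix n and X :: "nat \<Rightarrow> nat \<Rightarrow> complex^2^2"
  assume X: "block_psd n X"
  have cs: "cscale c A ** B ** C = cscale c (A ** B ** C)" for c and A B C :: "complex^2^2"
    by (simp add: qubit_eq_iff matrix_mult_nth_2 algebra_simps)
  show "block_psd n (\<lambda>k l. blinfun_apply
      (\<Sum>i<m. \<Sum>j<m. sandwich (cscale (G i j) (F i)) (dagger (F j))) (X k l))"
    unfolding block_psd_iff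
  proof
    fix v :: "nat \<Rightarrow> complex^2"
    define w where "w i k = dagger (F i) *v v k" for i k
    define Y where "Y i j = (\<Sum>k<n. \<Sum>l<n. sesq (w i k) (X k l) (w j l))" for i j
    \<comment> \<open>The form of \<open>Y\<close> at \<open>u\<close> is the form of
      \<open>X\<close> at the combinations of the \<open>w i k\<close> with coefficients
      \<open>u i\<close>; the chain below only moves the sums over \<open>i\<close> and
      \<open>j\<close> inside.\<close>
    have "psd_on {..<m} Y"
      unfolding psd_on_def
    proof
      fix u :: "nat \<Rightarrow> complex"
      have "(\<Sum>i<m. \<Sum>j<m. cnj (u i) * Y i j * u j)
          = (\<Sum>i<m. \<Sum>j<m. \<Sum>k<n. \<Sum>l<n. sesq (u i *s w i k) (X k l) (u j *s w j l))"
        by (simp add: Y_def sesq_mult sum_distrib_left sum_distrib_right)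
      also have "\<dots> = (\<Sum>i<m. \<Sum>k<n. \<Sum>j<m. \<Sum>l<n. sesq (u i *s w i k) (X k l) (u j *s w j l))"
        by (intro sum.cong refl sum.swap)
      also have "\<dots> = (\<Sum>k<n. \<Sum>i<m. \<Sum>j<m. \<Sum>l<n. sesq (u i *s w i k) (X k l) (u j *s w j l))"
        by (rule sum.swap)
      also have "\<dots> = (\<Sum>k<n. \<Sum>i<m. \<Sum>l<n. \<Sum>j<m. sesq (u i *s w i k) (X k l) (u j *s w j l))"
        by (intro sum.cong refl sum.swap)
      also have "\<dots> = (\<Sum>k<n. \<Sum>l<n. \<Sum>i<m. \<Sum>j<m. sesq (u i *s w i k) (X k l) (u j *s w j l))"
        by (intro sum.cong refl sum.swap)
      also have "\<dots> = (\<Sum>k<n. \<Sum>l<n. sesq (\<Sum>i<m. u i *s w i k) (X k l) (\<Sum>j<m. u j *s w j l))"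
        by (simp add: sesq_sum_left sesq_sum_right) (intro sum.cong refl sum.swap)
      also have "\<dots> \<in> \<real>\<^sub>\<ge>\<^sub>0"
        using X unfolding block_psd_iff by (rule spec)
      finally show "(\<Sum>i<m. \<Sum>j<m. cnj (u i) * Y i j * u j) \<in> \<real>\<^sub>\<ge>\<^sub>0" .
    qed
    then have GY: "(\<Sum>i<m. \<Sum>j<m. G i j * Y i j) \<in> \<real>\<^sub>\<ge>\<^sub>0"
      using G by (intro psd_on_sum_mult) auto
    let ?f = "\<lambda>i j k l. G i j * sesq (w i k) (X k l) (w j l)"
    have "(\<Sum>k<n. \<Sum>l<n. sesq (v k) (blinfun_apply
        (\<Sum>i<m. \<Sum>j<m. sandwich (cscale (G i j) (F i)) (dagger (F j))) (X k l)) (v l))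
      = (\<Sum>k<n. \<Sum>l<n. \<Sum>i<m. \<Sum>j<m. ?f i j k l)"
      by (simp add: blinfun.sum_left sesq_sum cs sesq_cscale sesq_sandwich w_def)
    also have "\<dots> = (\<Sum>k<n. \<Sum>i<m. \<Sum>l<n. \<Sum>j<m. ?f i j k l)"
      by (intro sum.cong refl sum.swap)
    also have "\<dots> = (\<Sum>k<n. \<Sum>i<m. \<Sum>j<m. \<Sum>l<n. ?f i j k l)"
      by (intro sum.cong refl sum.swap)
    also have "\<dots> = (\<Sum>i<m. \<Sum>k<n. \<Sum>j<m. \<Sum>l<n. ?f i j k l)"
      by (rule sum.swap)
    also have "\<dots> = (\<Sum>i<m. \<Sum>j<m. \<Sum>k<n. \<Sum>l<n. ?f i j k l)"
      by (intro sum.cong refl sum.swap)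
    also have "\<dots> = (\<Sum>i<m. \<Sum>j<m. G i j * Y i j)"
      by (simp add: Y_def sum_distrib_left)
    finally show "(\<Sum>k<n. \<Sum>l<n. sesq (v k) (blinfun_apply
        (\<Sum>i<m. \<Sum>j<m. sandwich (cscale (G i j) (F i)) (dagger (F j))) (X k l)) (v l)) \<in> \<real>\<^sub>\<ge>\<^sub>0"
      using GY by simp
  qed
qed

lemma closed_completely_positive: "closed (Collect completely_positive)"
proof -
  have "Collect completely_positive = (\<Inter>(n, X)\<in>{(n, X). block_psd n X}. \<Inter>v.
      {E. (\<Sum>i<n. \<Sum>j<n. sesq (v i) (blinfun_apply E (X i j)) (v j)) \<in> \<real>\<^sub>\<ge>\<^sub>0})"
    by (auto simp: completely_positive_def block_psd_iff)
  moreover have "closed {E :: superop. (\<Sum>i<n. \<Sum>j<n. sesq (v i) (blinfun_apply E (X i j)) (v j)) \<in> \<real>\<^sub>\<ge>\<^sub>0}"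
    for n v X
  proof -
    have "continuous_on UNIV (\<lambda>E :: superop. \<Sum>i<n. \<Sum>j<n. sesq (v i) (blinfun_apply E (X i j)) (v j))"
      by (intro continuous_on_sum continuous_on_compose2[OF continuous_sesq] continuous_intros) auto
    then show ?thesis
      using closed_vimage[OF closed_nonneg_Reals_complex] by (simp add: vimage_def)
  qed
  ultimately show ?thesis
    by (auto intro!: closed_INT)
qed

section \<open>Exponentials of Lindblad generators\<close>

definition lindblad_map ::
    "complex^2^2 \<Rightarrow> nat \<Rightarrow> (nat \<Rightarrow> nat \<Rightarrow> complex) \<Rightarrow> (nat \<Rightarrow> complex^2^2) \<Rightarrow> complex^2^2 \<Rightarrow> complex^2^2" where
  "lindblad_map H m G F \<rho> =
           cscale \<i> (\<rho> ** H - H ** \<rho>) +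
           (\<Sum>i<m. \<Sum>j<m. cscale (G i j)
              (F i ** \<rho> ** dagger (F j) -
               (1/2) *\<^sub>R (dagger (F j) ** F i ** \<rho> + \<rho> ** (dagger (F j) ** F i))))"

lemma lindblad_generator_iff:
  "lindblad_generator L \<longleftrightarrow> (\<exists>H m G F. dagger H = H \<and> (\<forall>i<m. \<forall>j<m. G j i = cnj (G i j)) \<and>
     psd_on {..<m} G \<and> (\<forall>\<rho>. blinfun_apply L \<rho> = lindblad_map H m G F \<rho>))"
  unfolding lindblad_generator_def lindblad_map_def by (rule refl)

definition complex_homogeneous :: "superop \<Rightarrow> bool" where
  "complex_homogeneous E \<longleftrightarrow> (\<forall>c \<rho>. blinfun_apply E (cscale c \<rho>) = cscale c (blinfun_apply E \<rho>))"

lemma dagger_simps: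
  fixes A B :: "complex^2^2"
  shows "dagger (A + B) = dagger A + dagger B" "dagger (A - B) = dagger A - dagger B" "dagger (A ** B) = dagger B ** dagger A"
    "dagger (dagger A) = A" "dagger (cscale c A) = cscale (cnj c) (dagger A)"
    "dagger (r *\<^sub>R A) = r *\<^sub>R dagger A" "dagger (mat 1 :: complex^2^2) = mat 1"
  by (simp_all add: qubit_eq_iff matrix_mult_nth_2 mat_def)

lemma dagger_sum: "dagger (\<Sum>i\<in>I. A i) = (\<Sum>i\<in>I. dagger (A i :: complex^2^2))"
  by (simp add: qubit_eq_iff cnj_sum)

lemma superop_power_apply:
  "blinfun_apply (((\<lambda>X. L o\<^sub>L X) ^^ n) id_blinfun) = blinfun_apply L ^^ n"
  for L :: superop
  by (induction n) (auto simp: fun_eq_iff)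

lemma superop_exp_apply_sums:
  "(\<lambda>n. (blinfun_apply L ^^ n) \<rho> /\<^sub>R fact n) sums blinfun_apply (superop_exp L) \<rho>"
proof -
  have "bounded_linear (\<lambda>X :: superop. blinfun_apply X \<rho>)"
    by (rule blinfun.bounded_linear_left)
  from bounded_linear.sums[OF this superop_exp_sums[of L]] show ?thesis
    by (simp add: blinfun.scaleR_left superop_power_apply)
qed

lemma superop_exp_eigenvector:
  assumes L: "complex_homogeneous L" and v: "blinfun_apply L v = cscale c v"
  shows "blinfun_apply (superop_exp L) v = cscale (exp c) v"
proof -
  have cc: "cscale a (cscale b A) = cscale (a * b) A" for a b and A :: "complex^2^2"
    by (simp add: qubit_eq_iff)
  have "(blinfun_apply L ^^ n) v = cscale (c ^ n) v" for n
  proof (induction n)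
    case 0
    show ?case by (simp add: qubit_eq_iff)
  next
    case (Suc n)
    then show ?case
      using L by (simp add: complex_homogeneous_def v cc mult.commute)
  qed
  then have "(\<lambda>n. cscale (c ^ n) v /\<^sub>R fact n) sums blinfun_apply (superop_exp L) v"
    using superop_exp_apply_sums[of L v] by simp
  moreover have "(\<lambda>n. cscale (c ^ n /\<^sub>R fact n) v) sums cscale (exp c) v"
    by (rule bounded_linear.sums[OF bounded_linear_cscale_left exp_converges])
  moreover have "cscale (c ^ n /\<^sub>R fact n) v = cscale (c ^ n) v /\<^sub>R fact n" for n
    by (simp add: qubit_eq_iff)
  ultimately show ?thesis
    by (simp add: sums_iff)
qed

lemma complex_homogeneous_superop_exp:
  assumes L: "complex_homogeneous L"
  shows "complex_homogeneous (superop_exp L)"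
  unfolding complex_homogeneous_def
proof (intro allI)
  fix c \<rho>
  have "(blinfun_apply L ^^ n) (cscale c \<rho>) = cscale c ((blinfun_apply L ^^ n) \<rho>)" for n
    using L by (induction n) (simp_all add: complex_homogeneous_def)
  then have "(\<lambda>n. cscale c ((blinfun_apply L ^^ n) \<rho> /\<^sub>R fact n)) sums blinfun_apply (superop_exp L) (cscale c \<rho>)"
    using superop_exp_apply_sums[of L "cscale c \<rho>"]
    by (simp add: bounded_linear.linear[OF bounded_linear_cscale] linear_scale)
  moreover have "(\<lambda>n. cscale c ((blinfun_apply L ^^ n) \<rho> /\<^sub>R fact n)) sums cscale c (blinfun_apply (superop_exp L) \<rho>)"
    by (rule bounded_linear.sums[OF bounded_linear_cscale superop_exp_apply_sums])
  ultimately show "blinfun_apply (superop_exp L) (cscale c \<rho>) = cscale c (blinfun_apply (superop_exp L) \<rho>)"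
    by (rule sums_unique2)
qed

lemma trace_superop_exp:
  assumes "\<And>\<rho>. trace (blinfun_apply L \<rho>) = 0"
  shows "trace (blinfun_apply (superop_exp L) \<rho>) = trace \<rho>"
proof -
  have "(\<lambda>n. trace ((blinfun_apply L ^^ n) \<rho> /\<^sub>R fact n)) sums trace (blinfun_apply (superop_exp L) \<rho>)"
    by (rule bounded_linear.sums[OF bounded_linear_trace superop_exp_apply_sums])
  moreover have "trace ((blinfun_apply L ^^ n) \<rho> /\<^sub>R fact n) = (if n = 0 then trace \<rho> else 0)" for n
    using assms by (cases n) (simp_all add: bounded_linear.linear[OF bounded_linear_trace] linear_scale)
  ultimately show ?thesis
    using sums_single[of 0 "\<lambda>_. trace \<rho>"] by (simp add: sums_unique2)
qed

lemma lindblad_generator_homogeneous: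
  assumes "lindblad_generator L"
  shows "complex_homogeneous L"
proof -
  obtain H m G F where L: "\<And>\<rho>. blinfun_apply L \<rho> = lindblad_map H m G F \<rho>"
    using assms unfolding lindblad_generator_iff by blast
  have "cscale c (\<Sum>i\<in>I. A i) = (\<Sum>i\<in>I. cscale c (A i))" for c I and A :: "nat \<Rightarrow> complex^2^2"
    by (simp add: bounded_linear.linear[OF bounded_linear_cscale] linear_sum)
  moreover have "cscale c (A + B) = cscale c A + cscale c B" for c and A B :: "complex^2^2"
    by (simp add: qubit_eq_iff algebra_simps)
  moreover have "cscale \<i> (cscale c \<rho> ** H - H ** cscale c \<rho>) = cscale c (cscale \<i> (\<rho> ** H - H ** \<rho>))" for c \<rho>
    by (simp add: qubit_eq_iff matrix_mult_nth_2 algebra_simps)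
  moreover have "cscale g (A ** cscale c \<rho> ** B - (1/2) *\<^sub>R (C ** cscale c \<rho> + cscale c \<rho> ** C))
      = cscale c (cscale g (A ** \<rho> ** B - (1/2) *\<^sub>R (C ** \<rho> + \<rho> ** C)))" for g c and A B C \<rho> :: "complex^2^2"
    by (simp add: qubit_eq_iff matrix_mult_nth_2) (simp add: scaleR_conv_of_real algebra_simps)
  ultimately show ?thesis
    by (simp add: complex_homogeneous_def L lindblad_map_def)
qed

lemma lindblad_generator_trace:
  assumes "lindblad_generator L"
  shows "trace (blinfun_apply L \<rho>) = 0"
proof -
  obtain H m G F where L: "\<And>\<rho>. blinfun_apply L \<rho> = lindblad_map H m G F \<rho>"
    using assms unfolding lindblad_generator_iff by blast
  have "trace (\<Sum>i\<in>I. A i) = (\<Sum>i\<in>I. trace (A i))" for I and A :: "nat \<Rightarrow> complex^2^2"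
    by (simp add: bounded_linear.linear[OF bounded_linear_trace] linear_sum)
  moreover have "trace (cscale \<i> (\<rho> ** H - H ** \<rho>)) = 0"
    by (simp add: trace_2 matrix_mult_nth_2 algebra_simps)
  moreover have "trace (cscale g (A ** \<rho> ** B - (1/2) *\<^sub>R (B ** A ** \<rho> + \<rho> ** (B ** A)))) = 0"
    for g and A B :: "complex^2^2"
    by (simp add: trace_2 matrix_mult_nth_2) (simp add: scaleR_conv_of_real algebra_simps)
  ultimately show ?thesis
    by (simp add: L lindblad_map_def trace_add)
qed

lemma lindblad_generator_scaleR:
  assumes "lindblad_generator L" "r \<ge> 0"
  shows "lindblad_generator (r *\<^sub>R L)"
proof -
  obtain H m G F where H: "dagger H = H" and G: "\<forall>i<m. \<forall>j<m. G j i = cnj (G i j)" "psd_on {..<m} G"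
    and L: "\<And>\<rho>. blinfun_apply L \<rho> = lindblad_map H m G F \<rho>"
    using assms unfolding lindblad_generator_iff by blast
  have psd: "psd_on {..<m} (\<lambda>i j. of_real r * G i j)"
    unfolding psd_on_def
  proof
    fix v :: "nat \<Rightarrow> complex"
    have "(\<Sum>i<m. \<Sum>j<m. cnj (v i) * (of_real r * G i j) * v j)
        = of_real r * (\<Sum>i<m. \<Sum>j<m. cnj (v i) * G i j * v j)"
      by (simp add: sum_distrib_left mult_ac)
    then show "(\<Sum>i<m. \<Sum>j<m. cnj (v i) * (of_real r * G i j) * v j) \<in> \<real>\<^sub>\<ge>\<^sub>0"
      using G(2) assms(2) unfolding psd_on_def by (simp add: nonneg_Reals_mult_I)
  qed
  have "cscale (of_real r * g) A = r *\<^sub>R cscale g A" for g and A :: "complex^2^2"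
    by (simp add: qubit_eq_iff) (simp add: scaleR_conv_of_real)
  moreover have "cscale \<i> (\<rho> ** (r *\<^sub>R H) - (r *\<^sub>R H) ** \<rho>) = r *\<^sub>R cscale \<i> (\<rho> ** H - H ** \<rho>)" for \<rho>
    by (simp add: qubit_eq_iff matrix_mult_nth_2) (simp add: scaleR_conv_of_real algebra_simps)
  ultimately have "blinfun_apply (r *\<^sub>R L) \<rho> = lindblad_map (r *\<^sub>R H) m (\<lambda>i j. of_real r * G i j) F \<rho>" for \<rho>
    by (simp add: L lindblad_map_def blinfun.scaleR_left scaleR_add_right scaleR_sum_right)
  moreover have "\<forall>i<m. \<forall>j<m. of_real r * G j i = cnj (of_real r * G i j)"
    by (metis G(1) complex_cnj_mult complex_cnj_complex_of_real)
  moreover have "dagger (r *\<^sub>R H) = r *\<^sub>R H"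
    by (simp add: dagger_simps H)
  ultimately show ?thesis
    unfolding lindblad_generator_iff using psd
    by (intro exI[of _ "r *\<^sub>R H"] exI[of _ m] exI[of _ "\<lambda>i j. of_real r * G i j"] exI[of _ F]) blast
qed

lemma completely_positive_lindblad_exp:
  assumes "lindblad_generator L"
  shows "completely_positive (superop_exp L)"
proof -
  obtain H m G F where H: "dagger H = H" and herm: "\<forall>i<m. \<forall>j<m. G j i = cnj (G i j)"
    and G: "psd_on {..<m} G"
    and L: "\<And>\<rho>. blinfun_apply L \<rho> = lindblad_map H m G F \<rho>"
    using assms unfolding lindblad_generator_iff by blast
  define S where "S = (\<Sum>i<m. \<Sum>j<m. cscale (G i j) (dagger (F j) ** F i))"
  define K where "K = cscale (- \<i>) H - (1/2) *\<^sub>R S"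
  define \<Phi> where "\<Phi> = (\<Sum>i<m. \<Sum>j<m. sandwich (cscale (G i j) (F i)) (dagger (F j)))"
  have "dagger S = S"
  proof -
    have "dagger S = (\<Sum>i<m. \<Sum>j<m. cscale (cnj (G i j)) (dagger (F i) ** F j))"
      by (simp add: S_def dagger_sum dagger_simps)
    also have "\<dots> = (\<Sum>i<m. \<Sum>j<m. cscale (G j i) (dagger (F i) ** F j))"
      by (intro sum.cong refl) (metis herm lessThan_iff)
    also have "\<dots> = S"
      unfolding S_def by (rule sum.swap)
    finally show ?thesis .
  qed
  then have K: "dagger K = cscale \<i> H - (1/2) *\<^sub>R S"
    using H by (simp add: K_def dagger_simps)
  have sum_mult: "(\<Sum>i\<in>I. A i) ** \<rho> = (\<Sum>i\<in>I. A i ** \<rho>)" "\<rho> ** (\<Sum>i\<in>I. A i) = (\<Sum>i\<in>I. \<rho> ** A i)"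
    for I :: "nat set" and A and \<rho> :: "complex^2^2"
    by (simp_all add: qubit_eq_iff matrix_mult_nth_2 sum.distrib sum_distrib_left sum_distrib_right)
  have LK: "blinfun_apply L \<rho> = K ** \<rho> + \<rho> ** dagger K + blinfun_apply \<Phi> \<rho>" for \<rho>
  proof -
    have "cscale g (A ** \<rho> ** B - (1/2) *\<^sub>R (B ** A ** \<rho> + \<rho> ** (B ** A)))
        = cscale g A ** \<rho> ** B - ((1/2) *\<^sub>R (cscale g (B ** A) ** \<rho>) + (1/2) *\<^sub>R (\<rho> ** cscale g (B ** A)))"
      for g and A B :: "complex^2^2"
      by (simp add: qubit_eq_iff matrix_mult_nth_2) (simp add: scaleR_conv_of_real algebra_simps)
    then have "blinfun_apply L \<rho> = cscale \<i> (\<rho> ** H - H ** \<rho>) + blinfun_apply \<Phi> \<rho>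
        - ((1/2) *\<^sub>R (S ** \<rho>) + (1/2) *\<^sub>R (\<rho> ** S))"
      by (simp add: L lindblad_map_def \<Phi>_def S_def blinfun.sum_left sum_mult sum.distrib sum_subtractf scaleR_sum_right)
    moreover have "K ** \<rho> + \<rho> ** dagger K
        = cscale \<i> (\<rho> ** H - H ** \<rho>) - ((1/2) *\<^sub>R (S ** \<rho>) + (1/2) *\<^sub>R (\<rho> ** S))"
      unfolding K by (simp add: K_def qubit_eq_iff matrix_mult_nth_2) (simp add: scaleR_conv_of_real algebra_simps)
    ultimately show ?thesis
      by simp
  qed
  \<comment> \<open>The second-order term completes the product: together with the part of
    \<open>L\<close> given by \<open>K\<close>, it turns the sum into the sandwich by
    \<open>1 + K / N\<close>.\<close>
  define T where "T N = id_blinfun + L /\<^sub>R real N + sandwich K (dagger K) /\<^sub>R (real N)\<^sup>2" for N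
  have T: "completely_positive (T N)" if "N > 0" for N
  proof -
    define A where "A = mat 1 + K /\<^sub>R real N"
    have "T N = sandwich A (dagger A) + \<Phi> /\<^sub>R real N"
    proof (rule blinfun_eqI)
      fix \<rho>
      have "blinfun_apply (T N) \<rho> = \<rho> + (K ** \<rho> + \<rho> ** dagger K) /\<^sub>R real N
          + (K ** \<rho> ** dagger K) /\<^sub>R (real N)\<^sup>2 + blinfun_apply \<Phi> \<rho> /\<^sub>R real N"
        by (simp add: T_def LK blinfun.add_left blinfun.scaleR_left scaleR_add_right)
      also have "\<rho> + (K ** \<rho> + \<rho> ** dagger K) /\<^sub>R real N + (K ** \<rho> ** dagger K) /\<^sub>R (real N)\<^sup>2
          = A ** \<rho> ** dagger A"
        by (simp add: A_def qubit_eq_iff matrix_mult_nth_2 dagger_simps mat_def)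
          (simp add: scaleR_conv_of_real algebra_simps power2_eq_square)
      finally show "blinfun_apply (T N) \<rho> = blinfun_apply (sandwich A (dagger A) + \<Phi> /\<^sub>R real N) \<rho>"
        by (simp add: blinfun.add_left blinfun.scaleR_left)
    qed
    then show ?thesis
      using completely_positive_sandwich_sum[OF G, of F]
      by (simp add: \<Phi>_def completely_positive_add completely_positive_sandwich completely_positive_scaleR)
  qed
  have pow: "completely_positive (Rep_endo (Abs_endo (T N) ^ k))" if "N > 0" for N k
    using T[OF that]
    by (induction k)
      (simp_all add: one_endo.rep_eq times_endo.rep_eq Abs_endo_inverse completely_positive_id
        completely_positive_compose)
  have "(\<lambda>N. Abs_endo (T N) ^ N) \<longlonglongrightarrow> exp (Abs_endo L)"
  proof (rule euler_limit)
    fix N :: nat assume "N > 0"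
    have "Abs_endo (T N) - (1 + Abs_endo L /\<^sub>R real N) = Abs_endo (sandwich K (dagger K) /\<^sub>R (real N)\<^sup>2)"
      by (simp add: one_endo_def scaleR_endo.abs_eq plus_endo.abs_eq minus_endo.abs_eq eq_onp_def T_def)
    then show "norm (Abs_endo (T N) - (1 + Abs_endo L /\<^sub>R real N)) \<le> norm (sandwich K (dagger K)) / (real N)\<^sup>2"
      by (simp add: norm_endo.abs_eq eq_onp_def divide_inverse mult.commute)
  qed
  then have "(\<lambda>N. Rep_endo (Abs_endo (T N) ^ N)) \<longlonglongrightarrow> superop_exp L"
    unfolding superop_exp_eq_exp by (rule bounded_linear.tendsto[OF bounded_linear_Rep_endo])
  moreover have "eventually (\<lambda>N. Rep_endo (Abs_endo (T N) ^ N) \<in> Collect completely_positive) sequentially"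
    using pow by (intro eventually_mono[OF eventually_gt_at_top[of 0]]) auto
  ultimately have "superop_exp L \<in> Collect completely_positive"
    by (intro Lim_in_closed_set[OF closed_completely_positive _ sequentially_bot])
  then show ?thesis by simp
qed

lemma qubit_channel_lindblad_exp:
  assumes "lindblad_generator L"
  shows "qubit_channel (superop_exp L)"
  using complex_homogeneous_superop_exp[OF lindblad_generator_homogeneous[OF assms]]
    completely_positive_lindblad_exp[OF assms] trace_superop_exp lindblad_generator_trace[OF assms]
  by (simp add: qubit_channel_def complex_homogeneous_def)

section \<open>Compactness of the set of channels\<close>

definition munit :: "2 \<Rightarrow> 2 \<Rightarrow> complex^2^2" where
  "munit i j = (\<chi> a b. if a = i \<and> b = j then 1 else 0)"

lemma munit_nth [simp]: "munit i j $ a $ b = (if a = i \<and> b = j then 1 else 0)"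
  by (simp add: munit_def)

text \<open>The blocks \<open>munit i j\<close> form the unnormalized maximally entangled projector,
  whose form is a squared modulus. Its blockwise image is the Choi matrix.\<close>

lemma choi_form_nonneg:
  assumes "completely_positive E"
  shows "(\<Sum>i\<in>UNIV. \<Sum>j\<in>UNIV. sesq (v i) (blinfun_apply E (munit i j)) (v j)) \<in> \<real>\<^sub>\<ge>\<^sub>0"
proof -
  \<comment> \<open>Blocks are numbered by naturals 0 and 1, matrix entries by the type
    \<open>2\<close>; \<open>ix\<close> translates.\<close>
  define ix :: "nat \<Rightarrow> 2" where "ix k = (if k = 0 then 1 else 2)" for k
  have sum_ix: "(\<Sum>k<2. f (ix k)) = (\<Sum>i\<in>UNIV. f i)" for f :: "2 \<Rightarrow> complex"
    by (simp add: ix_def sum_2 numeral_2_eq_2)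
  have "block_psd 2 (\<lambda>k l. munit (ix k) (ix l))"
    unfolding block_psd_iff
  proof
    fix u :: "nat \<Rightarrow> complex^2"
    have "(\<Sum>k<2. \<Sum>l<2. sesq (u k) (munit (ix k) (ix l)) (u l))
        = cnj (u 0 $ 1 + u 1 $ 2) * (u 0 $ 1 + u 1 $ 2)"
      by (simp add: numeral_2_eq_2 ix_def sesq_def sum_2 algebra_simps)
    also have "\<dots> = of_real ((cmod (u 0 $ 1 + u 1 $ 2))\<^sup>2)"
      unfolding complex_norm_square by (rule mult.commute)
    also have "\<dots> \<in> \<real>\<^sub>\<ge>\<^sub>0"
      by (simp only: nonneg_Reals_of_real_iff zero_le_power2)
    finally show "(\<Sum>k<2. \<Sum>l<2. sesq (u k) (munit (ix k) (ix l)) (u l)) \<in> \<real>\<^sub>\<ge>\<^sub>0" .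
  qed
  then have "block_psd 2 (\<lambda>k l. blinfun_apply E (munit (ix k) (ix l)))"
    using assms by (simp add: completely_positive_def)
  then have "(\<Sum>k<2. \<Sum>l<2. sesq (v (ix k)) (blinfun_apply E (munit (ix k) (ix l))) (v (ix l))) \<in> \<real>\<^sub>\<ge>\<^sub>0"
    unfolding block_psd_iff by (rule spec)
  then show ?thesis
    by (simp only: sum_ix[of "\<lambda>j. sesq (v i) (blinfun_apply E (munit i j)) (v j)" for i]
        sum_ix[of "\<lambda>i. \<Sum>j\<in>UNIV. sesq (v i) (blinfun_apply E (munit i j)) (v j)"])
qed

lemma choi_psd:
  assumes "completely_positive E"
  shows "psd_on UNIV (\<lambda>p q. blinfun_apply E (munit (fst p) (fst q)) $ snd p $ snd q)"
  unfolding psd_on_def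
proof
  fix v :: "2 \<times> 2 \<Rightarrow> complex"
  have UNIV_pairs: "(\<Sum>p\<in>UNIV. f p) = (\<Sum>i\<in>UNIV. \<Sum>a\<in>UNIV. f (i, a))" for f :: "2 \<times> 2 \<Rightarrow> complex"
    by (simp add: sum.cartesian_product)
  have "(\<Sum>p\<in>UNIV. \<Sum>q\<in>UNIV.
      cnj (v p) * blinfun_apply E (munit (fst p) (fst q)) $ snd p $ snd q * v q)
    = (\<Sum>i\<in>UNIV. \<Sum>a\<in>UNIV. \<Sum>j\<in>UNIV. \<Sum>b\<in>UNIV.
        cnj (v (i, a)) * blinfun_apply E (munit i j) $ a $ b * v (j, b))"
    by (simp only: UNIV_pairs fst_conv snd_conv)
  also have "\<dots> = (\<Sum>i\<in>UNIV. \<Sum>j\<in>UNIV.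
      sesq (\<chi> a. v (i, a)) (blinfun_apply E (munit i j)) (\<chi> b. v (j, b)))"
    unfolding sesq_def by (subst (2) sum.swap) simp
  also have "\<dots> \<in> \<real>\<^sub>\<ge>\<^sub>0"
    by (rule choi_form_nonneg[OF assms])
  finally show "(\<Sum>p\<in>UNIV. \<Sum>q\<in>UNIV.
      cnj (v p) * blinfun_apply E (munit (fst p) (fst q)) $ snd p $ snd q * v q) \<in> \<real>\<^sub>\<ge>\<^sub>0" .
qed

text \<open>Each diagonal block of the Choi matrix has trace 1 by trace preservation, so the
  diagonal entries lie between 0 and 1. The 2x2 minors carry the bound over to all entries.\<close>

lemma qubit_channel_entry_le_1:
  assumes "qubit_channel E"
  shows "cmod (blinfun_apply E (munit i j) $ a $ b) \<le> 1"
proof -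
  let ?C = "\<lambda>p q. blinfun_apply E (munit (fst p) (fst q)) $ snd p $ snd q"
  have psd: "psd_on UNIV ?C"
    using assms by (intro choi_psd) (simp add: qubit_channel_def)
  have diag: "0 \<le> Re (?C p p)" "Re (?C p p) \<le> 1" for p
  proof -
    obtain k c where p: "p = (k, c)" by (cases p)
    have pos: "Re (?C (k, d) (k, d)) \<ge> 0" for d
      using psd_on_diag[OF _ psd, of "(k, d)"] by (simp add: complex_nonneg_Reals_iff)
    have "trace (blinfun_apply E (munit k k)) = trace (munit k k)"
      using assms by (simp add: qubit_channel_def)
    also have "trace (munit k k) = 1"
      using exhaust_2[of k] by (auto simp: trace_2)
    finally have "Re (?C (k, 1) (k, 1)) + Re (?C (k, 2) (k, 2)) = 1"
      by (simp add: trace_2 flip: plus_complex.sel)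
    then show "0 \<le> Re (?C p p)" "Re (?C p p) \<le> 1"
      using pos[of 1] pos[of 2] exhaust_2[of c] p by auto
  qed
  have "(cmod (?C (i, a) (j, b)))\<^sup>2 \<le> Re (?C (i, a) (i, a)) * Re (?C (j, b) (j, b))"
    by (rule psd_on_minor[OF _ psd]) auto
  also have "\<dots> \<le> 1"
    using diag[of "(i, a)"] diag[of "(j, b)"] by (intro mult_le_one)
  finally show ?thesis
    by (simp add: power_le_one_iff abs_square_le_1)
qed

lemma munit_expansion: "\<rho> = (\<Sum>i\<in>UNIV. \<Sum>j\<in>UNIV. cscale (\<rho> $ i $ j) (munit i j))"
  for \<rho> :: "complex^2^2"
  by (simp add: qubit_eq_iff sum_2)

lemma qubit_channel_norm_le:
  assumes "qubit_channel E"
  shows "norm E \<le> 16"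
\<comment> \<open>The constant 16 is crude: four entries, each a sum of four products of modulus at
  most the norm of the argument.\<close>
proof (rule norm_blinfun_bound)
  fix \<rho> :: "complex^2^2"
  have hom: "blinfun_apply E (cscale c A) = cscale c (blinfun_apply E A)" for c A
    using assms by (simp add: qubit_channel_def)
  have entry: "cmod (\<rho> $ i $ j) \<le> norm \<rho>" for i j
    using Finite_Cartesian_Product.norm_nth_le[of \<rho> i] Finite_Cartesian_Product.norm_nth_le[of "\<rho> $ i" j] by (rule order_trans[rotated])
  have "cmod (blinfun_apply E \<rho> $ a $ b) \<le> 4 * norm \<rho>" for a b
  proof -
    have "blinfun_apply E \<rho> $ a $ b = (\<Sum>i\<in>UNIV. \<Sum>j\<in>UNIV. \<rho> $ i $ j * blinfun_apply E (munit i j) $ a $ b)"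
      by (subst munit_expansion[of \<rho>]) (simp add: blinfun.sum_right hom)
    also have "cmod \<dots> \<le> (\<Sum>i\<in>UNIV. \<Sum>j\<in>UNIV. cmod (\<rho> $ i $ j * blinfun_apply E (munit i j) $ a $ b))"
      by (intro order_trans[OF norm_sum] sum_mono norm_sum)
    also have "\<dots> \<le> (\<Sum>i\<in>(UNIV::2 set). \<Sum>j\<in>(UNIV::2 set). norm \<rho>)"
    proof (intro sum_mono)
      fix i j
      show "cmod (\<rho> $ i $ j * blinfun_apply E (munit i j) $ a $ b) \<le> norm \<rho>"
        using mult_mono[OF entry[of i j] qubit_channel_entry_le_1[OF assms, of i j a b]]
        by (simp add: norm_mult)
    qed
    finally show ?thesis by simp
  qed
  then have "norm (blinfun_apply E \<rho> $ a) \<le> (\<Sum>b\<in>(UNIV::2 set). 4 * norm \<rho>)" for a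
    unfolding norm_vec_def[of "blinfun_apply E \<rho> $ a"]
    by (intro order_trans[OF L2_set_le_sum] sum_mono) auto
  then have "norm (blinfun_apply E \<rho>) \<le> (\<Sum>a\<in>(UNIV::2 set). \<Sum>b\<in>(UNIV::2 set). 4 * norm \<rho>)"
    unfolding norm_vec_def[of "blinfun_apply E \<rho>"]
    by (intro order_trans[OF L2_set_le_sum] sum_mono) auto
  then show "norm (blinfun_apply E \<rho>) \<le> 16 * norm \<rho>"
    by simp
qed simp

lemma compact_qubit_channels: "compact (Collect qubit_channel)"
proof -
  have cont: "continuous_on UNIV (\<lambda>E :: superop. blinfun_apply E \<rho>)" for \<rho>
    by (intro continuous_intros)
  have cs: "continuous_on UNIV (cscale c :: complex^2^2 \<Rightarrow> _)" for c
    by (rule linear_continuous_on[OF bounded_linear_cscale])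
  have tr: "continuous_on UNIV (trace :: complex^2^2 \<Rightarrow> _)"
    by (rule linear_continuous_on[OF bounded_linear_trace])
  have "closed {E :: superop. blinfun_apply E (cscale c \<rho>) = cscale c (blinfun_apply E \<rho>)}" for c \<rho>
    by (intro closed_Collect_eq cont continuous_on_compose2[OF cs cont]) auto
  moreover have "closed {E :: superop. trace (blinfun_apply E \<rho>) = trace \<rho>}" for \<rho>
    by (intro closed_Collect_eq continuous_on_compose2[OF tr cont] continuous_intros) auto
  ultimately have "closed (Collect qubit_channel)"
    unfolding qubit_channel_def
    by (intro closed_Collect_conj closed_Collect_all closed_completely_positive)
  moreover have "bounded (Collect qubit_channel)"
    using qubit_channel_norm_le by (auto simp: bounded_iff)
  ultimately show ?thesis
    by (simp add: compact_eq_bounded_closed)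
qed

section \<open>From L-divisibility to infinite divisibility\<close>

lemma L_divisible_imp_infinitely_divisible:
  assumes "L_divisible E"
  shows "infinitely_divisible E"
  unfolding infinitely_divisible_def
proof (intro conjI allI impI)
  show "qubit_channel E" using assms by (simp add: L_divisible_def)
  fix n :: nat
  assume "n > 0"
  \<comment> \<open>The power is formed in the space of superoperators, because its continuity in
    the operator norm makes the image of the set of channels compact.\<close>
  define pow where "pow X = ((\<lambda>Y. X o\<^sub>L Y) ^^ n) id_blinfun" for X :: superop
  have "continuous_on UNIV (\<lambda>X :: superop. ((\<lambda>Y. X o\<^sub>L Y) ^^ k) id_blinfun)" for k
    by (induction k) (auto intro!: continuous_intros)
  then have "compact (pow ` Collect qubit_channel)"
    unfolding pow_def using compact_qubit_channels
    by (intro compact_continuous_image) (auto intro: continuous_on_subset)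
  moreover have "{E'. qubit_channel E' \<and> bij (blinfun_apply E') \<and>
      (\<exists>L. lindblad_generator L \<and> E' = superop_exp L)} \<subseteq> pow ` Collect qubit_channel"
  proof clarify
    fix L assume "lindblad_generator L"
    then have "lindblad_generator (L /\<^sub>R real n)"
      by (rule lindblad_generator_scaleR) simp
    then have "qubit_channel (superop_exp (L /\<^sub>R real n))"
      by (rule qubit_channel_lindblad_exp)
    moreover have "superop_exp L = pow (superop_exp (L /\<^sub>R real n))"
      using superop_exp_power[OF \<open>n > 0\<close>, of L]
      by (intro blinfun_eqI) (simp add: pow_def superop_power_apply)
    ultimately show "superop_exp L \<in> pow ` Collect qubit_channel"
      by blast
  qed
  ultimately have "E \<in> pow ` Collect qubit_channel"
    using assms closure_minimal compact_imp_closed unfolding L_divisible_def by blast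
  then show "\<exists>En. qubit_channel En \<and> blinfun_apply E = blinfun_apply En ^^ n"
    by (auto simp: pow_def superop_power_apply)
qed

section \<open>Powers of real matrices with a diagonal power\<close>

definition dmat :: "real^'n \<Rightarrow> real^'n^'n" where
  "dmat l = (\<chi> i j. if i = j then l $ i else 0)"

definition mpow :: "real^'n^'n \<Rightarrow> nat \<Rightarrow> real^'n^'n" where
  "mpow T n = ((\<lambda>M. T ** M) ^^ n) (mat 1)"

lemma mpow_0 [simp]: "mpow T 0 = mat 1" and mpow_Suc [simp]: "mpow T (Suc n) = T ** mpow T n"
  by (simp_all add: mpow_def)

lemma mpow_commute: "T ** mpow T n = mpow T n ** T"
  by (induction n) (simp_all add: matrix_mul_assoc)

lemma dmat_nth [simp]: "dmat l $ i $ j = (if i = j then l $ i else 0)"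
  by (simp add: dmat_def)

text \<open>\<open>T\<close> commutes with its own power \<open>dmat l\<close>; comparing entries
  gives \<open>T $ i $ j * l $ j = l $ i * T $ i $ j\<close>.\<close>

lemma entry_zero_of_power_dmat:
  assumes "mpow T n = dmat l" "l $ i \<noteq> l $ j"
  shows "T $ i $ j = 0"
proof -
  have "(T ** dmat l) $ i $ j = T $ i $ j * l $ j"
    by (simp add: matrix_matrix_mult_def if_distrib if_distribR cong: if_cong)
  moreover have "(dmat l ** T) $ i $ j = l $ i * T $ i $ j"
    by (simp add: matrix_matrix_mult_def if_distrib if_distribR cong: if_cong)
  ultimately show ?thesis
    using mpow_commute[of T n] assms by (metis mult.commute mult_cancel_left)
qed

lemma sum_3_distinct:
  fixes i j k :: 3
  assumes "i \<noteq> j" "j \<noteq> k" "i \<noteq> k"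
  shows "(\<Sum>x\<in>UNIV. f x) = f i + f j + (f k :: 'a::comm_monoid_add)"
  using assms exhaust_3[of i] exhaust_3[of j] exhaust_3[of k]
  by (auto simp: sum_3 ac_simps)

text \<open>The block structure survives multiplication, and both the isolated entry and the
  determinant of the 2x2 block are multiplicative. The entries of the block itself have no such
  simple powers.\<close>

lemma mpow_block:
  fixes T :: "real^3^3"
  assumes ijk: "i \<noteq> j" "j \<noteq> k" "i \<noteq> k"
    and z: "T $ i $ k = 0" "T $ j $ k = 0" "T $ k $ i = 0" "T $ k $ j = 0"
  defines "P \<equiv> mpow T"
  shows "P n $ i $ k = 0 \<and> P n $ j $ k = 0 \<and> P n $ k $ i = 0 \<and> P n $ k $ j = 0 \<and>
    P n $ k $ k = (T $ k $ k) ^ n \<and>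
    P n $ i $ i * P n $ j $ j - P n $ i $ j * P n $ j $ i
      = (T $ i $ i * T $ j $ j - T $ i $ j * T $ j $ i) ^ n"
proof (induction n)
  case 0
  show ?case using ijk by (auto simp: P_def mat_def)
next
  case (Suc n)
  have step: "P (Suc n) $ a $ b = T $ a $ i * P n $ i $ b + T $ a $ j * P n $ j $ b + T $ a $ k * P n $ k $ b" for a b
    by (simp add: P_def matrix_matrix_mult_def sum_3_distinct[OF ijk])
  have "P (Suc n) $ i $ i * P (Suc n) $ j $ j - P (Suc n) $ i $ j * P (Suc n) $ j $ i
      = (T $ i $ i * T $ j $ j - T $ i $ j * T $ j $ i) * (P n $ i $ i * P n $ j $ j - P n $ i $ j * P n $ j $ i)"
    using Suc by (simp add: step z algebra_simps)
  then show ?case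
    using Suc by (simp add: step z)
qed

section \<open>The Bloch matrix of a channel\<close>

text \<open>Indexing by the type \<open>3\<close> makes the Pauli matrices label the coordinates of
  \<open>real^3\<close>.\<close>

definition sg :: "3 \<Rightarrow> complex^2^2" where
  "sg i = pauli (if i = 1 then 1 else if i = 2 then 2 else 3)"

lemma sg_nth:
  "sg 1 $ 1 $ 1 = 0" "sg 1 $ 1 $ 2 = 1" "sg 1 $ 2 $ 1 = 1" "sg 1 $ 2 $ 2 = 0"
  "sg 2 $ 1 $ 1 = 0" "sg 2 $ 1 $ 2 = - \<i>" "sg 2 $ 2 $ 1 = \<i>" "sg 2 $ 2 $ 2 = 0"
  "sg 3 $ 1 $ 1 = 1" "sg 3 $ 1 $ 2 = 0" "sg 3 $ 2 $ 1 = 0" "sg 3 $ 2 $ 2 = -1"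
  by (simp_all add: sg_def pauli_def numeral_2_eq_2 numeral_3_eq_3)

lemma mat_1_nth:
  "(mat 1 :: complex^2^2) $ 1 $ 1 = 1" "(mat 1 :: complex^2^2) $ 1 $ 2 = 0"
  "(mat 1 :: complex^2^2) $ 2 $ 1 = 0" "(mat 1 :: complex^2^2) $ 2 $ 2 = 1"
  by (simp_all add: mat_def)

text \<open>The linear part of the affine action on the Bloch ball; the translation, which is the
  traceless part of the image of the identity, is left out.\<close>

definition bloch :: "superop \<Rightarrow> real^3^3" where
  "bloch X = (\<chi> i j. Re (trace (sg i ** blinfun_apply X (sg j))) / 2)"

text \<open>This is the Hermitian symmetry of the Choi matrix, a consequence of its
  positivity.\<close>

lemma qubit_channel_dagger:
  assumes "qubit_channel X"
  shows "blinfun_apply X (dagger \<rho>) = dagger (blinfun_apply X \<rho>)"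
proof -
  have hom: "blinfun_apply X (cscale c A) = cscale c (blinfun_apply X A)" for c A
    using assms by (simp add: qubit_channel_def)
  have psd: "psd_on UNIV (\<lambda>p q. blinfun_apply X (munit (fst p) (fst q)) $ snd p $ snd q)"
    using assms by (intro choi_psd) (simp add: qubit_channel_def)
  have entry: "blinfun_apply X (munit j i) $ b $ a = cnj (blinfun_apply X (munit i j) $ a $ b)" for i j a b
    using psd_on_hermitian[OF finite psd UNIV_I UNIV_I, of "(j, b)" "(i, a)"]
    by (simp only: fst_conv snd_conv)
  have "blinfun_apply X (dagger \<rho>) $ a $ b = dagger (blinfun_apply X \<rho>) $ a $ b" for a b
    by (subst (2) munit_expansion[of \<rho>], subst munit_expansion[of "dagger \<rho>"])
      (simp add: blinfun.add_right hom sum_2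
        entry[of 1 1 b a] entry[of 1 2 b a] entry[of 2 1 b a] entry[of 2 2 b a])
  then show ?thesis by (simp add: vec_eq_iff)
qed

lemma hermitian_traceless_expansion:
  assumes "dagger A = A" "trace A = 0"
  shows "A = (\<Sum>i\<in>UNIV. (Re (trace (sg i ** A)) / 2) *\<^sub>R sg i)"
proof -
  have h: "A $ 2 $ 1 = cnj (A $ 1 $ 2)" "Im (A $ 1 $ 1) = 0" "A $ 2 $ 2 = - A $ 1 $ 1"
    using arg_cong[OF assms(1), of "\<lambda>M. M $ 2 $ 1"] arg_cong[OF assms(1), of "\<lambda>M. Im (M $ 1 $ 1)"] assms(2)
    by (simp_all add: trace_2 eq_neg_iff_add_eq_0 add.commute)
  then show ?thesis
    by (simp add: qubit_eq_iff sum_3 trace_2 matrix_mult_nth_2 sg_nth complex_eq_iff)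
qed

lemma qubit_channel_sg:
  assumes "qubit_channel X"
  shows "blinfun_apply X (sg k) = (\<Sum>i\<in>UNIV. bloch X $ i $ k *\<^sub>R sg i)"
proof -
  have sg: "dagger (sg k) = sg k" "trace (sg k) = 0"
    using exhaust_3[of k] by (auto simp: qubit_eq_iff trace_2 sg_nth)
  have "dagger (blinfun_apply X (sg k)) = blinfun_apply X (sg k)"
    using qubit_channel_dagger[OF assms, of "sg k"] sg by simp
  moreover have "trace (blinfun_apply X (sg k)) = 0"
    using assms sg by (simp add: qubit_channel_def)
  ultimately show ?thesis
    using hermitian_traceless_expansion by (simp add: bloch_def)
qed

text \<open>The traceless Hermitian matrices form an invariant subspace, so the translation of a
  non-unital channel never enters the powers.\<close>

lemma qubit_channel_power_sg:
  assumes "qubit_channel X"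
  shows "(blinfun_apply X ^^ n) (sg k) = (\<Sum>i\<in>UNIV. mpow (bloch X) n $ i $ k *\<^sub>R sg i)"
proof (induction n)
  case 0
  show ?case
    using exhaust_3[of k] by (auto simp: sum_3 mat_def)
next
  case (Suc n)
  let ?T = "bloch X"
  have "(blinfun_apply X ^^ Suc n) (sg k)
      = (\<Sum>j\<in>UNIV. \<Sum>i\<in>UNIV. (mpow ?T n $ j $ k * ?T $ i $ j) *\<^sub>R sg i)"
    by (simp add: Suc blinfun.sum_right blinfun.scaleR_right qubit_channel_sg[OF assms] scaleR_sum_right)
  also have "\<dots> = (\<Sum>i\<in>UNIV. \<Sum>j\<in>UNIV. (mpow ?T n $ j $ k * ?T $ i $ j) *\<^sub>R sg i)"
    by (rule sum.swap)
  also have "\<dots> = (\<Sum>i\<in>UNIV. mpow ?T (Suc n) $ i $ k *\<^sub>R sg i)"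
    by (simp add: matrix_matrix_mult_def scaleR_sum_left mult.commute)
  finally show ?case .
qed

lemma mpow_bloch_eq_dmat:
  assumes X: "qubit_channel X" and E: "\<And>k. (blinfun_apply X ^^ n) (sg k) = l $ k *\<^sub>R sg k"
  shows "mpow (bloch X) n = dmat l"
proof -
  have "mpow (bloch X) n $ i $ k = dmat l $ i $ k" for i k
  proof -
    have "(\<Sum>i\<in>UNIV. mpow (bloch X) n $ i $ k *\<^sub>R sg i) = l $ k *\<^sub>R sg k"
      using qubit_channel_power_sg[OF X] E by metis
    then have "Re (trace (sg i ** (\<Sum>i\<in>UNIV. mpow (bloch X) n $ i $ k *\<^sub>R sg i))) / 2
        = Re (trace (sg i ** (l $ k *\<^sub>R sg k))) / 2"
      by simp
    moreover have "Re (trace (sg i ** (\<Sum>i\<in>UNIV. mpow (bloch X) n $ i $ k *\<^sub>R sg i))) / 2 = mpow (bloch X) n $ i $ k"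
      using exhaust_3[of i] by (auto simp: sum_3 trace_2 matrix_mult_nth_2 sg_nth)
    moreover have "Re (trace (sg i ** (l $ k *\<^sub>R sg k))) / 2 = dmat l $ i $ k"
      using exhaust_3[of i] exhaust_3[of k] by (auto simp: trace_2 matrix_mult_nth_2 sg_nth)
    ultimately show ?thesis by simp
  qed
  then show ?thesis by (simp add: vec_eq_iff)
qed

section \<open>The Choi matrix in the Bell basis and its minors\<close>

text \<open>
  The Choi form of \<open>X\<close> at the vector with the entries of \<open>A\<close>; the vectors of \<open>mat 1\<close> and of
  the \<open>sg k\<close> are the four Bell states, up to normalization.
\<close>
definition bell_form :: "superop \<Rightarrow> complex^2^2 \<Rightarrow> complex" where
  "bell_form X A = (\<Sum>i\<in>UNIV. \<Sum>j\<in>UNIV. sesq (column i A) (blinfun_apply X (munit i j)) (column j A))"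

text \<open>For these triples \<open>sg i ** sg j\<close> is \<open>\<i>\<close> times
  \<open>sg k\<close>; the orientation fixes the signs in \<open>bell_form_eq\<close>.\<close>

definition cyclic :: "3 \<Rightarrow> 3 \<Rightarrow> 3 \<Rightarrow> bool" where
  "cyclic i j k \<longleftrightarrow> (i, j, k) \<in> {(1, 2, 3), (2, 3, 1), (3, 1, 2)}"

text \<open>The Choi form on two planes, each spanned by a pair of Bell vectors. The off-diagonal
  entry on the first plane shows the antisymmetric part of the \<open>(i, j)\<close> block of
  \<open>T\<close>, on the second the symmetric part. The number \<open>t\<close> is the
  \<open>k\<close>-th component of the translation.\<close>

lemma bell_form_eq:
  assumes X: "qubit_channel X" and ijk: "cyclic i j k"
  defines "T \<equiv> bloch X"
  defines "t \<equiv> Re (trace (sg k ** blinfun_apply X (mat 1))) / 2"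
  shows "bell_form X (cscale x (mat 1) + cscale y (sg k)) =
      cnj x * of_real (1 + T $ i $ i + T $ j $ j + T $ k $ k) * x
      + cnj x * Complex t (T $ j $ i - T $ i $ j) * y
      + cnj y * Complex t (T $ i $ j - T $ j $ i) * x
      + cnj y * of_real (1 + T $ k $ k - T $ i $ i - T $ j $ j) * y" (is ?A)
    and "bell_form X (cscale x (sg i) + cscale y (sg j)) =
      cnj x * of_real (1 + T $ i $ i - T $ j $ j - T $ k $ k) * x
      + cnj x * Complex (T $ i $ j + T $ j $ i) (- t) * y
      + cnj y * Complex (T $ i $ j + T $ j $ i) t * x
      + cnj y * of_real (1 - T $ i $ i + T $ j $ j - T $ k $ k) * y" (is ?B)
proof -
  let ?R = "blinfun_apply X (mat 1)"
  have "dagger (mat 1 :: complex^2^2) = mat 1" "trace (mat 1 :: complex^2^2) = 2"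
    by (simp add: dagger_simps, simp add: trace_2 mat_def)
  then have "dagger ?R = ?R" "trace ?R = 2"
    using qubit_channel_dagger[OF X, of "mat 1"] X by (simp_all add: qubit_channel_def)
  note R_eqs = this
  have R: "?R $ 2 $ 1 = cnj (?R $ 1 $ 2)" "Im (?R $ 1 $ 1) = 0" "?R $ 2 $ 2 = 2 - ?R $ 1 $ 1"
    using arg_cong[OF R_eqs(1), of "\<lambda>M. M $ 2 $ 1"]
      arg_cong[OF R_eqs(1), of "\<lambda>M. Im (M $ 1 $ 1)"] R_eqs(2)
    by (simp_all add: trace_2 algebra_simps)
  have hom: "blinfun_apply X (cscale c A) = cscale c (blinfun_apply X A)" for c A
    using X by (simp add: qubit_channel_def)
  \<comment> \<open>In the Pauli basis the action of \<open>X\<close> is known: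
    \<open>bloch X\<close> on the \<open>sg i\<close>, and the Hermitian matrix \<open>?R\<close> of
    trace 2 on the identity.\<close>
  have "munit 1 1 = (1/2) *\<^sub>R (mat 1 + sg 3)" "munit 2 2 = (1/2) *\<^sub>R (mat 1 - sg 3)"
    "munit 1 2 = (1/2) *\<^sub>R (sg 1 + cscale \<i> (sg 2))" "munit 2 1 = (1/2) *\<^sub>R (sg 1 - cscale \<i> (sg 2))"
    by (simp_all add: qubit_eq_iff sg_nth mat_1_nth) (simp_all add: scaleR_conv_of_real)
  then have e: "blinfun_apply X (munit 1 1) = (1/2) *\<^sub>R (?R + (\<Sum>i\<in>UNIV. T $ i $ 3 *\<^sub>R sg i))"
    "blinfun_apply X (munit 2 2) = (1/2) *\<^sub>R (?R - (\<Sum>i\<in>UNIV. T $ i $ 3 *\<^sub>R sg i))"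
    "blinfun_apply X (munit 1 2) = (1/2) *\<^sub>R ((\<Sum>i\<in>UNIV. T $ i $ 1 *\<^sub>R sg i) + cscale \<i> (\<Sum>i\<in>UNIV. T $ i $ 2 *\<^sub>R sg i))"
    "blinfun_apply X (munit 2 1) = (1/2) *\<^sub>R ((\<Sum>i\<in>UNIV. T $ i $ 1 *\<^sub>R sg i) - cscale \<i> (\<Sum>i\<in>UNIV. T $ i $ 2 *\<^sub>R sg i))"
    by (simp_all add: T_def blinfun.scaleR_right blinfun.add_right blinfun.diff_right hom qubit_channel_sg[OF X])
  show ?A
    using ijk unfolding cyclic_def t_def
    by (auto simp: bell_form_def sum_2 e sesq_def column_def sum_3 sg_nth mat_1_nth R trace_2
        matrix_mult_nth_2 complex_eq_iff) (simp_all add: field_simps)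
  show ?B
    using ijk unfolding cyclic_def t_def
    by (auto simp: bell_form_def sum_2 e sesq_def column_def sum_3 sg_nth mat_1_nth R trace_2
        matrix_mult_nth_2 complex_eq_iff) (simp_all add: field_simps)
qed

text \<open>The diagonal entries on each plane are a sum and a difference of the same two terms, so
  their product is a difference of squares. Dropping the square of \<open>t\<close> leaves the two
  inequalities; adding the diagonal entries of each plane gives the third claim.\<close>

lemma bloch_minors_cyclic:
  assumes X: "qubit_channel X" and ijk: "cyclic i j k"
  defines "T \<equiv> bloch X"
  shows "(T $ i $ i + T $ j $ j)\<^sup>2 + (T $ i $ j - T $ j $ i)\<^sup>2 \<le> (1 + T $ k $ k)\<^sup>2"
    and "(T $ i $ i - T $ j $ j)\<^sup>2 + (T $ i $ j + T $ j $ i)\<^sup>2 \<le> (1 - T $ k $ k)\<^sup>2"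
    and "\<bar>T $ k $ k\<bar> \<le> 1"
proof -
  have "bell_form X A \<in> \<real>\<^sub>\<ge>\<^sub>0" for A
    unfolding bell_form_def using X by (intro choi_form_nonneg) (simp add: qubit_channel_def)
  note form = this[of "cscale x (mat 1) + cscale y (sg k)" for x y]
    this[of "cscale x (sg i) + cscale y (sg j)" for x y]
  define t where "t = Re (trace (sg k ** blinfun_apply X (mat 1))) / 2"
  note f1 = psd_two_form[OF form(1)[unfolded bell_form_eq[OF X ijk]], folded T_def t_def]
  note f2 = psd_two_form[OF form(2)[unfolded bell_form_eq[OF X ijk]], folded T_def t_def]
  show "(T $ i $ i + T $ j $ j)\<^sup>2 + (T $ i $ j - T $ j $ i)\<^sup>2 \<le> (1 + T $ k $ k)\<^sup>2"
    using f1(4) unfolding cmod_power2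
    by (simp add: power2_eq_square algebra_simps, use zero_le_square[of t] in linarith)
  show "(T $ i $ i - T $ j $ j)\<^sup>2 + (T $ i $ j + T $ j $ i)\<^sup>2 \<le> (1 - T $ k $ k)\<^sup>2"
    using f2(4) unfolding cmod_power2
    by (simp add: power2_eq_square algebra_simps, use zero_le_square[of t] in linarith)
  show "\<bar>T $ k $ k\<bar> \<le> 1"
    using f1(1,2) f2(1,2) by (simp add: complex_nonneg_Reals_iff)
qed

text \<open>Exchanging \<open>i\<close> and \<open>j\<close> changes only signs under the squares,
  so both orientations are covered.\<close>

lemma bloch_minors:
  fixes i j k :: 3
  assumes X: "qubit_channel X" and ijk: "i \<noteq> j" "j \<noteq> k" "i \<noteq> k"
  defines "T \<equiv> bloch X"
  shows "(T $ i $ i + T $ j $ j)\<^sup>2 + (T $ i $ j - T $ j $ i)\<^sup>2 \<le> (1 + T $ k $ k)\<^sup>2"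
    and "(T $ i $ i - T $ j $ j)\<^sup>2 + (T $ i $ j + T $ j $ i)\<^sup>2 \<le> (1 - T $ k $ k)\<^sup>2"
    and "\<bar>T $ k $ k\<bar> \<le> 1"
proof -
  have "cyclic i j k \<or> cyclic j i k"
    using ijk exhaust_3[of i] exhaust_3[of j] exhaust_3[of k] by (auto simp: cyclic_def)
  then show "(T $ i $ i + T $ j $ j)\<^sup>2 + (T $ i $ j - T $ j $ i)\<^sup>2 \<le> (1 + T $ k $ k)\<^sup>2"
    "(T $ i $ i - T $ j $ j)\<^sup>2 + (T $ i $ j + T $ j $ i)\<^sup>2 \<le> (1 - T $ k $ k)\<^sup>2"
    "\<bar>T $ k $ k\<bar> \<le> 1"
    using bloch_minors_cyclic[OF X, of i j k] bloch_minors_cyclic[OF X, of j i k]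
    by (auto simp: T_def power2_commute add.commute)
qed

section \<open>Eigenvalues of infinitely divisible channels\<close>

lemma root_abs_of_power_eq:
  assumes "x ^ n = y" "n > 0"
  shows "root n \<bar>y\<bar> = \<bar>x\<bar>"
  using assms by (metis abs_ge_zero power_abs real_root_pos2)

lemma root_eigenvalue_triangle:
  fixes i j k :: 3
  assumes X: "qubit_channel X" and pow: "mpow (bloch X) n = dmat l" and n: "odd n"
    and ijk: "i \<noteq> j" "j \<noteq> k" "i \<noteq> k" and le: "\<And>m. \<bar>l $ m\<bar> \<le> 1"
    and nonneg: "l $ k \<noteq> l $ i \<Longrightarrow> l $ k \<noteq> l $ j \<Longrightarrow> l $ k \<ge> 0"
  shows "root n \<bar>l $ i\<bar> + root n \<bar>l $ j\<bar> \<le> 1 + root n \<bar>l $ k\<bar>"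
proof (cases "l $ k = l $ i \<or> l $ k = l $ j")
  \<comment> \<open>The root for \<open>k\<close> cancels against an equal one on the left; the
    remaining root is at most 1.\<close>
  case True
  have "n > 0" using n by (rule odd_pos)
  then have "root n \<bar>l $ m\<bar> \<le> 1" for m
    using le by simp
  from this[of i] this[of j] show ?thesis using True by auto
next
  case False
  have "n > 0" using n by (rule odd_pos)
  define T where "T = bloch X"
  have z: "T $ a $ b = 0" if "l $ a \<noteq> l $ b" for a b
    using pow that unfolding T_def by (rule entry_zero_of_power_dmat)
  have block: "dmat l $ k $ k = (T $ k $ k) ^ n"
    "dmat l $ i $ i * dmat l $ j $ j - dmat l $ i $ j * dmat l $ j $ i
      = (T $ i $ i * T $ j $ j - T $ i $ j * T $ j $ i) ^ n"
    using mpow_block[OF ijk, of T n] z False unfolding pow[folded T_def] by metis+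
  then have Tk: "(T $ k $ k) ^ n = l $ k"
    by simp
  moreover have "l $ k \<ge> 0" using False nonneg by auto
  \<comment> \<open>Only for odd \<open>n\<close> does the sign of the power determine the sign of
    the base.\<close>
  ultimately have "T $ k $ k \<ge> 0"
    using n by (metis zero_le_power_eq even_Suc)
  then have rk: "root n \<bar>l $ k\<bar> = T $ k $ k"
    using root_abs_of_power_eq[OF Tk \<open>n > 0\<close>] by simp
  note minors = bloch_minors[OF X ijk, folded T_def]
  show ?thesis
  proof (cases "l $ i = l $ j")
    case True
    define d where "d = T $ i $ i * T $ j $ j - T $ i $ j * T $ j $ i"
    define r where "r = root n \<bar>l $ i\<bar>"
    have "d ^ n = (l $ i)\<^sup>2"
      using block(2) True ijk by (simp add: d_def power2_eq_square)
    then have "\<bar>d\<bar> = root n (\<bar>l $ i\<bar>\<^sup>2)"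
      using root_abs_of_power_eq[OF _ \<open>n > 0\<close>] by (metis abs_power2 power2_abs)
    also have "\<dots> = r\<^sup>2"
      unfolding r_def using \<open>n > 0\<close> by (rule real_root_power)
    finally have d: "\<bar>d\<bar> = r\<^sup>2" .
    \<comment> \<open>Polarization: \<open>4 * d\<close> is the left side of the first minor
      inequality minus the left side of the second. Each of them is nonnegative, so one bounds
      \<open>4 * d\<close> and the other its negative.\<close>
    have "4 * d \<le> (1 + T $ k $ k)\<^sup>2"
    proof -
      have "0 \<le> (T $ i $ i - T $ j $ j)\<^sup>2 + (T $ i $ j + T $ j $ i)\<^sup>2" by simp
      then show ?thesis
        using minors(1) unfolding d_def power2_eq_square by (simp only: algebra_simps)
    qed
    moreover have "- (4 * d) \<le> (1 + T $ k $ k)\<^sup>2"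
    proof -
      have "0 \<le> (T $ i $ i + T $ j $ j)\<^sup>2 + (T $ i $ j - T $ j $ i)\<^sup>2" by simp
      moreover have "(1 - T $ k $ k)\<^sup>2 \<le> (1 + T $ k $ k)\<^sup>2"
        using \<open>T $ k $ k \<ge> 0\<close> minors(3) by (intro power_mono) auto
      ultimately show ?thesis
        using minors(2) unfolding d_def power2_eq_square by (simp only: algebra_simps)
    qed
    ultimately have "(2 * r)\<^sup>2 \<le> (1 + T $ k $ k)\<^sup>2"
      using d by (auto simp: power_mult_distrib)
    then have "2 * r \<le> 1 + T $ k $ k"
      by (rule power2_le_imp_le) (use \<open>T $ k $ k \<ge> 0\<close> in simp)
    then show ?thesis
      using True by (simp add: rk r_def)
  next
    case neq: False
    \<comment> \<open>With three distinct eigenvalues \<open>T\<close> is diagonal, and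
      \<open>mpow_block\<close> is applied with \<open>i\<close>, then \<open>j\<close>, as the
      isolated index.\<close>
    have "dmat l $ i $ i = (T $ i $ i) ^ n"
      using mpow_block[of j k i T n] z False neq ijk unfolding pow[folded T_def] by metis
    then have ri: "root n \<bar>l $ i\<bar> = \<bar>T $ i $ i\<bar>"
      by (intro root_abs_of_power_eq \<open>n > 0\<close>) simp
    have "dmat l $ j $ j = (T $ j $ j) ^ n"
      using mpow_block[of i k j T n] z False neq ijk unfolding pow[folded T_def] by metis
    then have rj: "root n \<bar>l $ j\<bar> = \<bar>T $ j $ j\<bar>"
      by (intro root_abs_of_power_eq \<open>n > 0\<close>) simp
    have "T $ i $ j = 0" "T $ j $ i = 0"
      using z neq by auto
    then have "\<bar>T $ i $ i + T $ j $ j\<bar> \<le> \<bar>1 + T $ k $ k\<bar>" "\<bar>T $ i $ i - T $ j $ j\<bar> \<le> \<bar>1 - T $ k $ k\<bar>"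
      using minors(1,2) by (simp_all add: abs_le_square_iff)
    then show ?thesis
      using \<open>T $ k $ k \<ge> 0\<close> minors(3) unfolding rk ri rj by linarith
  qed
qed

text \<open>An eigenvalue different from the other two is the square of a real diagonal entry, hence
  nonnegative. A negative one must therefore be repeated, and multiplicity three is excluded by the
  determinant.\<close>

lemma square_root_eigenvalues:
  fixes T :: "real^3^3"
  assumes sq: "mpow T 2 = dmat l"
  shows "(\<forall>i. l $ i \<ge> 0) \<or> (\<exists>i j k. cyclic i j k \<and> l $ i = l $ j \<and> l $ i < 0 \<and> l $ k \<ge> 0)"
proof -
  have simple: "l $ k \<ge> 0" if "i \<noteq> j" "j \<noteq> k" "i \<noteq> k" "l $ k \<noteq> l $ i" "l $ k \<noteq> l $ j" for i j k
  proof -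
    have z: "T $ a $ b = 0" if "l $ a \<noteq> l $ b" for a b
      using sq that by (rule entry_zero_of_power_dmat)
    have "dmat l $ k $ k = (T $ k $ k) ^ 2"
      using mpow_block[OF that(1-3) z z z z, of 2] that(4,5) unfolding sq by metis
    then show ?thesis by simp
  qed
  \<comment> \<open>If all three agree, \<open>T\<close> may be any square root of a scalar matrix,
    but the determinant of that scalar matrix, a cube, is still a square.\<close>
  have const: "l $ 1 \<ge> 0" if "l $ 1 = l $ 2" "l $ 2 = l $ 3"
  proof -
    have "(det T)\<^sup>2 = det (dmat l)"
      unfolding sq[symmetric] by (simp add: numeral_2_eq_2 det_mul power2_eq_square)
    also have "det (dmat l) = (l $ 1) ^ 3"
      using that by (simp add: det_3 power3_eq_cube)
    finally show ?thesis
      by (metis zero_le_power2 zero_le_odd_power odd_numeral)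
  qed
  have pair: ?thesis if "cyclic i j k" "i \<noteq> j" "j \<noteq> k" "i \<noteq> k" "l $ i = l $ j" "l $ j \<noteq> l $ k" for i j k
  proof -
    have "l $ k \<ge> 0"
      using simple[of i j k] that by metis
    show ?thesis
    proof (cases "l $ i < 0")
      case True
      then show ?thesis using that \<open>l $ k \<ge> 0\<close> by blast
    next
      case False
      have "l $ m \<ge> 0" for m
        using that(1,5) False \<open>l $ k \<ge> 0\<close> exhaust_3[of m] by (auto simp: cyclic_def)
      then show ?thesis by blast
    qed
  qed
  consider "l $ 1 = l $ 2" "l $ 2 \<noteq> l $ 3" | "l $ 2 = l $ 3" "l $ 3 \<noteq> l $ 1"
    | "l $ 3 = l $ 1" "l $ 1 \<noteq> l $ 2" | "l $ 1 = l $ 2" "l $ 2 = l $ 3"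
    | "l $ 1 \<noteq> l $ 2" "l $ 2 \<noteq> l $ 3" "l $ 3 \<noteq> l $ 1"
    by metis
  then show ?thesis
  proof cases
    case 1
    then show ?thesis by (intro pair[of 1 2 3]) (auto simp: cyclic_def)
  next
    case 2
    then show ?thesis by (intro pair[of 2 3 1]) (auto simp: cyclic_def)
  next
    case 3
    then show ?thesis by (intro pair[of 3 1 2]) (auto simp: cyclic_def)
  next
    case 4
    then show ?thesis using const by (auto simp: forall_3)
  next
    case 5
    then show ?thesis
      using simple[of 1 2 3] simple[of 2 3 1] simple[of 3 1 2] by (auto simp: forall_3)
  qed
qed

section \<open>Pauli-diagonal maps and their generators\<close>

lemma pauli_eq: "pauli 0 = mat 1" "pauli 1 = sg 1" "pauli (Suc 0) = sg 1" "pauli 2 = sg 2" "pauli 3 = sg 3"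
  by (simp_all add: sg_def pauli_def)

lemma sum_lessThan_4: "(\<Sum>i<4. f i) = f 0 + f 1 + f 2 + f (3::nat)"
  by (simp add: numeral_eq_Suc)

lemma pauli_basis_expansion:
  "A = cscale (trace A / 2) (mat 1) + (\<Sum>i\<in>UNIV. cscale (trace (sg i ** A) / 2) (sg i))"
  by (simp add: qubit_eq_iff sum_3 trace_2 matrix_mult_nth_2 sg_nth mat_1_nth field_simps)

text \<open>Real linearity and homogeneity give complex linearity, and the four Pauli matrices
  span.\<close>

lemma complex_homogeneous_eqI:
  assumes "complex_homogeneous X" "complex_homogeneous Y"
    and "blinfun_apply X (mat 1) = blinfun_apply Y (mat 1)"
    and "\<And>i. blinfun_apply X (sg i) = blinfun_apply Y (sg i)"
  shows "X = Y"
proof (rule blinfun_eqI)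
  fix A
  have "blinfun_apply Z A = cscale (trace A / 2) (blinfun_apply Z (mat 1))
      + (\<Sum>i\<in>UNIV. cscale (trace (sg i ** A) / 2) (blinfun_apply Z (sg i)))"
    if "complex_homogeneous Z" for Z
    using that by (subst pauli_basis_expansion[of A])
      (simp add: complex_homogeneous_def blinfun.add_right blinfun.sum_right)
  then show "blinfun_apply X A = blinfun_apply Y A"
    using assms by simp
qed

text \<open>The inverse of the sign transform that takes the weights of a Pauli channel to its
  eigenvalues, with eigenvalue 1 on the identity. Nonnegativity of all four weights describes the
  tetrahedron of Pauli channels.\<close>

definition pauli_weight :: "real^3 \<Rightarrow> nat \<Rightarrow> real" where
  "pauli_weight m i =
     [1 + m $ 1 + m $ 2 + m $ 3, 1 + m $ 1 - m $ 2 - m $ 3,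
      1 - m $ 1 + m $ 2 - m $ 3, 1 - m $ 1 - m $ 2 + m $ 3] ! i / 4"

lemma pauli_weight_nth:
  "pauli_weight m 0 = (1 + m $ 1 + m $ 2 + m $ 3) / 4"
  "pauli_weight m 1 = (1 + m $ 1 - m $ 2 - m $ 3) / 4"
  "pauli_weight m 2 = (1 - m $ 1 + m $ 2 - m $ 3) / 4"
  "pauli_weight m 3 = (1 - m $ 1 - m $ 2 + m $ 3) / 4"
  by (simp_all add: pauli_weight_def)

definition pdiag :: "real^3 \<Rightarrow> superop" where
  "pdiag m = (\<Sum>i<4. pauli_weight m i *\<^sub>R sandwich (pauli i) (pauli i))"

lemma pauli_conj_homogeneous: "complex_homogeneous (\<Sum>i<4. w i *\<^sub>R sandwich (pauli i) (pauli i))"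
proof -
  have "A ** cscale c \<rho> ** A = cscale c (A ** \<rho> ** A)" for c and A \<rho> :: "complex^2^2"
    by (simp add: qubit_eq_iff matrix_mult_nth_2 algebra_simps)
  moreover have "r *\<^sub>R cscale c A = cscale c (r *\<^sub>R A)" for r c and A :: "complex^2^2"
    by (simp add: qubit_eq_iff)
  moreover have "cscale c (A + B) = cscale c A + cscale c B" for c and A B :: "complex^2^2"
    by (simp add: qubit_eq_iff algebra_simps)
  ultimately show ?thesis
    by (simp add: complex_homogeneous_def sum_lessThan_4 blinfun.add_left blinfun.scaleR_left)
qed

lemma pauli_conj_apply:
  defines "W w \<equiv> (\<Sum>i<4. w i *\<^sub>R sandwich (pauli i) (pauli i))"
  shows "blinfun_apply (W w) (mat 1) = (\<Sum>i<4. w i) *\<^sub>R mat 1"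
    "blinfun_apply (W w) (sg 1) = (w 0 + w 1 - w 2 - w 3) *\<^sub>R sg 1"
    "blinfun_apply (W w) (sg 2) = (w 0 - w 1 + w 2 - w 3) *\<^sub>R sg 2"
    "blinfun_apply (W w) (sg 3) = (w 0 - w 1 - w 2 + w 3) *\<^sub>R sg 3"
  by (simp_all add: W_def sum_lessThan_4 blinfun.add_left blinfun.scaleR_left pauli_eq
      qubit_eq_iff matrix_mult_nth_2 sg_nth mat_1_nth)
    (simp_all add: scaleR_conv_of_real algebra_simps)

lemma pdiag_homogeneous: "complex_homogeneous (pdiag m)"
  unfolding pdiag_def by (rule pauli_conj_homogeneous)

lemma sum_pauli_weight: "(\<Sum>i<4. pauli_weight m i) = 1"
  unfolding sum_lessThan_4 pauli_weight_nth by (simp add: field_simps)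

lemma pdiag_apply:
  "blinfun_apply (pdiag m) (mat 1) = mat 1"
  "blinfun_apply (pdiag m) (sg k) = m $ k *\<^sub>R sg k"
proof -
  show "blinfun_apply (pdiag m) (mat 1) = mat 1"
    unfolding pdiag_def pauli_conj_apply sum_pauli_weight by simp
  have "(1 + a + b + c) / 4 + (1 + a - b - c) / 4 - (1 - a + b - c) / 4 - (1 - a - b + c) / 4 = a"
    "(1 + a + b + c) / 4 - (1 + a - b - c) / 4 + (1 - a + b - c) / 4 - (1 - a - b + c) / 4 = b"
    "(1 + a + b + c) / 4 - (1 + a - b - c) / 4 - (1 - a + b - c) / 4 + (1 - a - b + c) / 4 = c"
    for a b c :: real
    by (simp_all add: field_simps)
  then have "blinfun_apply (pdiag m) (sg 1) = m $ 1 *\<^sub>R sg 1"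
    "blinfun_apply (pdiag m) (sg 2) = m $ 2 *\<^sub>R sg 2"
    "blinfun_apply (pdiag m) (sg 3) = m $ 3 *\<^sub>R sg 3"
    unfolding pdiag_def pauli_conj_apply pauli_weight_nth by simp_all
  then show "blinfun_apply (pdiag m) (sg k) = m $ k *\<^sub>R sg k"
    using exhaust_3[of k] by auto
qed

lemma bij_pdiag:
  assumes "\<And>k. m $ k \<noteq> 0"
  shows "bij (blinfun_apply (pdiag m))"
proof -
  have hom: "complex_homogeneous (pdiag a o\<^sub>L pdiag b)" for a b
    using pdiag_homogeneous by (simp add: complex_homogeneous_def)
  have id: "complex_homogeneous id_blinfun"
    by (simp add: complex_homogeneous_def)
  have inv: "pdiag a o\<^sub>L pdiag b = id_blinfun" if "\<And>k. a $ k * b $ k = 1" for a b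
    using that by (intro complex_homogeneous_eqI hom id)
      (simp_all add: pdiag_apply blinfun.scaleR_right mult.commute)
  define m' where "m' = (\<chi> k. inverse (m $ k))"
  have "pdiag m' o\<^sub>L pdiag m = id_blinfun" "pdiag m o\<^sub>L pdiag m' = id_blinfun"
    using assms by (auto intro!: inv simp: m'_def)
  then have "blinfun_apply (pdiag m') (blinfun_apply (pdiag m) \<rho>) = \<rho>"
      "blinfun_apply (pdiag m) (blinfun_apply (pdiag m') \<rho>) = \<rho>" for \<rho>
    by (metis blinfun_apply_blinfun_compose blinfun_apply_id_blinfun)+
  then show ?thesis
    by (intro o_bij[of "blinfun_apply (pdiag m')"]) (simp_all add: fun_eq_iff)
qed

lemma tendsto_pdiag:
  assumes "\<And>k. (\<lambda>n. m n $ k) \<longlonglongrightarrow> l $ k"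
  shows "(\<lambda>n. pdiag (m n)) \<longlonglongrightarrow> pdiag l"
  unfolding pdiag_def sum_lessThan_4 pauli_weight_nth
  by (intro tendsto_add tendsto_scaleR tendsto_divide tendsto_diff tendsto_const assms) simp_all

lemma pauli_channel_eq_pdiag:
  assumes "pauli_channel E"
  obtains l where "E = pdiag l"
proof -
  obtain p :: "nat \<Rightarrow> real" where p: "(\<Sum>i<4. p i) = 1"
    and E: "\<And>\<rho>. blinfun_apply E \<rho> = (\<Sum>i<4. p i *\<^sub>R (pauli i ** \<rho> ** pauli i))"
    using assms unfolding pauli_channel_def by blast
  \<comment> \<open>Conjugation by a Pauli matrix fixes those commuting with it and negates the
    others, which gives these signs. The weights are recovered because the \<open>p i\<close> add up
    to 1.\<close>
  define l :: "real^3" where "l = (\<chi> k. if k = 1 then p 0 + p 1 - p 2 - p 3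
    else if k = 2 then p 0 - p 1 + p 2 - p 3 else p 0 - p 1 - p 2 + p 3)"
  have "E = (\<Sum>i<4. p i *\<^sub>R sandwich (pauli i) (pauli i))"
    by (rule blinfun_eqI) (simp add: E blinfun.sum_left blinfun.scaleR_left)
  moreover have "pauli_weight l i = p i" if "i < 4" for i
  proof -
    have "i = 0 \<or> i = 1 \<or> i = 2 \<or> i = 3" using that by auto
    then show ?thesis
      using p by (auto simp: pauli_weight_nth l_def sum_lessThan_4 simp flip: One_nat_def)
  qed
  then have "(\<Sum>i<4. pauli_weight l i *\<^sub>R sandwich (pauli i) (pauli i))
      = (\<Sum>i<4. p i *\<^sub>R sandwich (pauli i) (pauli i))"
    by (intro sum.cong refl) simp
  ultimately have "E = pdiag l"
    unfolding pdiag_def by simp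
  then show ?thesis ..
qed

section \<open>Explicit generators and their exponentials\<close>

definition hamiltonian_part :: "complex^2^2 \<Rightarrow> superop" where
  "hamiltonian_part H = sandwich (cscale \<i> (mat 1)) H - sandwich (cscale \<i> H) (mat 1)"

lemma hamiltonian_part_apply:
  "blinfun_apply (hamiltonian_part H) \<rho> = cscale \<i> (\<rho> ** H - H ** \<rho>)"
  by (simp add: hamiltonian_part_def blinfun.diff_left qubit_eq_iff matrix_mult_nth_2 mat_1_nth algebra_simps)

definition pauli_generator :: "real \<Rightarrow> real^3 \<Rightarrow> complex^2^2 \<Rightarrow> superop" where
  "pauli_generator s r H = s *\<^sub>R (pdiag r - id_blinfun) + hamiltonian_part H"

text \<open>The jump operators are the Pauli matrices with a diagonal \<open>G\<close>. They are
  Hermitian with square 1, so each anticommutator reduces to a multiple of \<open>\<rho>\<close>,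
  and since the weights add up to 1 the total is \<open>s\<close> times
  \<open>pdiag r - id_blinfun\<close>.\<close>

lemma lindblad_pauli_generator:
  assumes s: "s \<ge> 0" and r: "\<And>i. i < 4 \<Longrightarrow> pauli_weight r i \<ge> 0" and H: "dagger H = H"
  shows "lindblad_generator (pauli_generator s r H)"
proof -
  define G where "G i j = (if i = j then complex_of_real (s * pauli_weight r i) else 0)" for i j
  have "\<forall>i<4. \<forall>j<4. G j i = cnj (G i j)"
    by (auto simp: G_def)
  moreover have "psd_on {..<4} G"
    unfolding psd_on_def
  proof
    fix v :: "nat \<Rightarrow> complex"
    have "(\<Sum>i<4. \<Sum>j<4. cnj (v i) * G i j * v j) = (\<Sum>i<4. complex_of_real (s * pauli_weight r i * (cmod (v i))\<^sup>2))"
    proof -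
      have "complex_of_real (cmod z) ^ 2 = z * cnj z" for z
        using complex_norm_square[of z] by simp
      then show ?thesis
        by (simp add: sum_lessThan_4 G_def mult_ac flip: One_nat_def)
    qed
    also have "\<dots> = complex_of_real (\<Sum>i<4. s * pauli_weight r i * (cmod (v i))\<^sup>2)"
      by simp
    also have "\<dots> \<in> \<real>\<^sub>\<ge>\<^sub>0"
      unfolding nonneg_Reals_of_real_iff using s r by (intro sum_nonneg mult_nonneg_nonneg) auto
    finally show "(\<Sum>i<4. \<Sum>j<4. cnj (v i) * G i j * v j) \<in> \<real>\<^sub>\<ge>\<^sub>0" .
  qed
  moreover have "blinfun_apply (pauli_generator s r H) \<rho> = lindblad_map H 4 G pauli \<rho>" for \<rho>
  proof -
    have sg2: "dagger (pauli i) = pauli i \<and> pauli i ** pauli i = mat 1" if "i < 4" for i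
    proof -
      have "i = 0 \<or> i = 1 \<or> i = 2 \<or> i = 3" using that by auto
      then show ?thesis
        by (auto simp: pauli_eq qubit_eq_iff matrix_mult_nth_2 sg_nth mat_1_nth)
    qed
    let ?t = "\<lambda>i. s * pauli_weight r i"
    have "cscale (G i j) (pauli i ** \<rho> ** dagger (pauli j)
          - (1/2) *\<^sub>R (dagger (pauli j) ** pauli i ** \<rho> + \<rho> ** (dagger (pauli j) ** pauli i)))
        = (if i = j then ?t i *\<^sub>R (pauli i ** \<rho> ** pauli i) - ?t i *\<^sub>R \<rho> else 0)"
      if "i < 4" "j < 4" for i j
    proof (cases "i = j")
      case True
      have c: "cscale (complex_of_real x) A = x *\<^sub>R A" for x and A :: "complex^2^2"
        by (simp add: qubit_eq_iff) (simp add: scaleR_conv_of_real)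
      have h: "(1/2) *\<^sub>R (\<rho> + \<rho>) = \<rho>"
        by (simp flip: scaleR_2)
      show ?thesis
        using True sg2[OF that(2)] by (simp add: G_def c h scaleR_diff_right del: of_real_mult)
    next
      case False
      then show ?thesis by (simp add: G_def qubit_eq_iff)
    qed
    then have "lindblad_map H 4 G pauli \<rho> = cscale \<i> (\<rho> ** H - H ** \<rho>)
        + (\<Sum>i<4. \<Sum>j<4. if i = j then ?t i *\<^sub>R (pauli i ** \<rho> ** pauli i) - ?t i *\<^sub>R \<rho> else 0)"
      by (simp add: lindblad_map_def)
    also have "(\<Sum>i<4. \<Sum>j<4. if i = j then ?t i *\<^sub>R (pauli i ** \<rho> ** pauli i) - ?t i *\<^sub>R \<rho> else 0)
        = (\<Sum>i<4. ?t i *\<^sub>R (pauli i ** \<rho> ** pauli i)) - (\<Sum>i<4. ?t i) *\<^sub>R \<rho>"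
      by (simp add: sum_subtractf scaleR_sum_left)
    also have "(\<Sum>i<4. ?t i) = s"
      by (simp add: sum_pauli_weight flip: sum_distrib_left)
    finally show ?thesis
      by (simp add: pauli_generator_def pdiag_def hamiltonian_part_apply blinfun.add_left
          blinfun.diff_left blinfun.scaleR_left blinfun.sum_left scaleR_diff_right scaleR_sum_right)
  qed
  ultimately show ?thesis
    unfolding lindblad_generator_iff using H
    by (intro exI[of _ H] exI[of _ 4] exI[of _ G] exI[of _ pauli]) blast
qed

lemma superop_exp_pauli_generator:
  assumes "lindblad_generator (pauli_generator s r 0)"
  shows "superop_exp (pauli_generator s r 0) = pdiag (\<chi> k. exp (s * (r $ k - 1)))"
proof -
  define L where "L = pauli_generator s r 0"
  have hom: "complex_homogeneous L"
    unfolding L_def by (rule lindblad_generator_homogeneous[OF assms])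
  have z: "hamiltonian_part 0 = 0"
    by (rule blinfun_eqI) (simp add: hamiltonian_part_apply qubit_eq_iff matrix_mult_nth_2)
  have 1: "blinfun_apply L (mat 1) = cscale 0 (mat 1)"
    by (simp add: L_def z pauli_generator_def blinfun.add_left blinfun.diff_left blinfun.scaleR_left
        pdiag_apply qubit_eq_iff)
  have c: "x *\<^sub>R A = cscale (complex_of_real x) A" for x and A :: "complex^2^2"
    by (simp add: qubit_eq_iff) (simp add: scaleR_conv_of_real)
  have 2: "blinfun_apply L (sg k) = cscale (of_real (s * (r $ k - 1))) (sg k)" for k
    unfolding c[symmetric] by (simp add: L_def z pauli_generator_def blinfun.add_left blinfun.diff_left
        blinfun.scaleR_left pdiag_apply algebra_simps)
  have "superop_exp L = pdiag (\<chi> k. exp (s * (r $ k - 1)))"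
  proof (rule complex_homogeneous_eqI[OF complex_homogeneous_superop_exp[OF hom] pdiag_homogeneous])
    show "blinfun_apply (superop_exp L) (mat 1) = blinfun_apply (pdiag (\<chi> k. exp (s * (r $ k - 1)))) (mat 1)"
      using superop_exp_eigenvector[OF hom 1] by (simp add: pdiag_apply qubit_eq_iff)
    show "blinfun_apply (superop_exp L) (sg k) = blinfun_apply (pdiag (\<chi> k. exp (s * (r $ k - 1)))) (sg k)" for k
      using superop_exp_eigenvector[OF hom 2[of k]] unfolding exp_of_real by (simp add: pdiag_apply c)
  qed
  then show ?thesis by (simp add: L_def)
qed

text \<open>
  The Hamiltonian rotates the plane of \<open>sg i\<close> and \<open>sg j\<close> by the angle \<open>\<pi>\<close>, so it commutes
  with the dissipative part and flips the sign of the two equal eigenvalues.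
\<close>
lemma superop_exp_pauli_generator_rotated:
  assumes "lindblad_generator (pauli_generator s r ((pi / 2) *\<^sub>R sg k))"
    and ijk: "cyclic i j k" and eq: "r $ i = r $ j"
  shows "superop_exp (pauli_generator s r ((pi / 2) *\<^sub>R sg k))
    = pdiag (\<chi> m. (if m = k then 1 else -1) * exp (s * (r $ m - 1)))" (is "_ = pdiag ?m")
proof -
  define L where "L = pauli_generator s r ((pi / 2) *\<^sub>R sg k)"
  have hom: "complex_homogeneous L"
    unfolding L_def by (rule lindblad_generator_homogeneous[OF assms(1)])
  have hom_exp: "complex_homogeneous (superop_exp L)"
    by (rule complex_homogeneous_superop_exp[OF hom])
  have c: "x *\<^sub>R A = cscale (complex_of_real x) A" for x and A :: "complex^2^2"
    by (simp add: qubit_eq_iff) (simp add: scaleR_conv_of_real)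
  define a where "a = s * (r $ i - 1)"
  have 1: "blinfun_apply L (mat 1) = cscale 0 (mat 1)"
    by (simp add: L_def pauli_generator_def blinfun.add_left blinfun.diff_left blinfun.scaleR_left
        hamiltonian_part_apply pdiag_apply qubit_eq_iff)
  have Lsg: "blinfun_apply L (sg m) = (s * (r $ m - 1)) *\<^sub>R sg m
      + cscale \<i> (sg m ** ((pi / 2) *\<^sub>R sg k) - ((pi / 2) *\<^sub>R sg k) ** sg m)" for m
    by (simp add: L_def pauli_generator_def blinfun.add_left blinfun.diff_left
        blinfun.scaleR_left pdiag_apply hamiltonian_part_apply algebra_simps)
  have Lk: "blinfun_apply L (sg k) = cscale (of_real (s * (r $ k - 1))) (sg k)"
  proof -
    have "cscale \<i> (sg k ** (x *\<^sub>R sg k) - (x *\<^sub>R sg k) ** sg k) = 0" for x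
      by (simp add: qubit_eq_iff matrix_mult_nth_2)
    then show ?thesis
      unfolding c[symmetric] Lsg by simp
  qed
  \<comment> \<open>The commutator of two different Pauli matrices is twice the third up to a phase,
    which turns \<open>pi / 2\<close> into \<open>pi\<close>.\<close>
  have Li: "blinfun_apply L (sg i) = a *\<^sub>R sg i + pi *\<^sub>R sg j"
    and Lj: "blinfun_apply L (sg j) = a *\<^sub>R sg j - pi *\<^sub>R sg i"
    unfolding Lsg a_def eq[symmetric] c using ijk unfolding cyclic_def
    by (auto simp: qubit_eq_iff matrix_mult_nth_2 sg_nth complex_eq_iff)
  \<comment> \<open>On the plane of \<open>sg i\<close> and \<open>sg j\<close> the generator is
    \<open>a\<close> plus a rotation generator, so the circular combinations diagonalize it. Their
    eigenvalues \<open>a - \<i> * pi\<close> and \<open>a + \<i> * pi\<close> have the same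
    exponential \<open>- exp a\<close>, hence the exponential is a scalar on the plane.\<close>
  define vp where "vp = sg i + cscale \<i> (sg j)"
  define vm where "vm = sg i - cscale \<i> (sg j)"
  have Lvp: "blinfun_apply L vp = cscale (of_real a - \<i> * of_real pi) vp"
    and Lvm: "blinfun_apply L vm = cscale (of_real a + \<i> * of_real pi) vm"
    unfolding vp_def vm_def blinfun.add_right blinfun.diff_right hom[unfolded complex_homogeneous_def, rule_format] Li Lj c
    by (simp_all add: qubit_eq_iff algebra_simps)
  have e: "exp (of_real a - \<i> * of_real pi) = - complex_of_real (exp a)"
    "exp (of_real a + \<i> * of_real pi) = - complex_of_real (exp a)"
    by (simp_all add: exp_diff exp_add exp_of_real)
  have ep: "blinfun_apply (superop_exp L) vp = cscale (- complex_of_real (exp a)) vp"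
    using superop_exp_eigenvector[OF hom Lvp] unfolding e .
  have em: "blinfun_apply (superop_exp L) vm = cscale (- complex_of_real (exp a)) vm"
    using superop_exp_eigenvector[OF hom Lvm] unfolding e .
  have si: "sg i = cscale (1/2) (vp + vm)" and sj: "sg j = cscale (- \<i> / 2) (vp - vm)"
    by (simp_all add: vp_def vm_def qubit_eq_iff)
  have "superop_exp L = pdiag ?m"
  proof (rule complex_homogeneous_eqI[OF hom_exp pdiag_homogeneous])
    show "blinfun_apply (superop_exp L) (mat 1) = blinfun_apply (pdiag ?m) (mat 1)"
      using superop_exp_eigenvector[OF hom 1] by (simp add: pdiag_apply qubit_eq_iff)
    have comb: "cscale x (cscale z A + cscale z B) = cscale z (cscale x (A + B))"
      "cscale x (cscale z A - cscale z B) = cscale z (cscale x (A - B))"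
      for x z and A B :: "complex^2^2"
      by (simp_all add: qubit_eq_iff algebra_simps)
    have i: "blinfun_apply (superop_exp L) (sg i) = cscale (- complex_of_real (exp a)) (sg i)"
      unfolding si hom_exp[unfolded complex_homogeneous_def, rule_format] blinfun.add_right ep em comb ..
    have j: "blinfun_apply (superop_exp L) (sg j) = cscale (- complex_of_real (exp a)) (sg j)"
      unfolding sj hom_exp[unfolded complex_homogeneous_def, rule_format] blinfun.diff_right ep em comb ..
    have k: "blinfun_apply (superop_exp L) (sg k) = cscale (complex_of_real (exp (s * (r $ k - 1)))) (sg k)"
      using superop_exp_eigenvector[OF hom Lk] unfolding exp_of_real .
    show "blinfun_apply (superop_exp L) (sg m) = blinfun_apply (pdiag ?m) (sg m)" for m
    proof -
      have "i \<noteq> k" "j \<noteq> k" "m = i \<or> m = j \<or> m = k"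
        using ijk exhaust_3[of m] by (auto simp: cyclic_def)
      then show ?thesis
        using i j k eq by (auto simp: pdiag_apply c a_def)
    qed
  qed
  then show ?thesis by (simp add: L_def)
qed

section \<open>Approximation of infinitely divisible Pauli channels\<close>

lemma exp_root_tendsto:
  assumes "x \<ge> 0"
  shows "(\<lambda>n. exp (real (2 * n + 1) * (root (2 * n + 1) x - 1))) \<longlonglongrightarrow> x"
proof -
  have mono: "strict_mono (\<lambda>n::nat. 2 * n)"
    by (simp add: strict_mono_def)
  show ?thesis
  proof (cases "x = 0")
    case True
    \<comment> \<open>A root of 0 is 0, so the sequence is \<open>exp (- 1)\<close> to growing
      powers. In this way singular channels become limits of invertible ones.\<close>
    have "(\<lambda>n. exp (- 1 :: real) ^ n) \<longlonglongrightarrow> 0"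
      by (rule LIMSEQ_realpow_zero) auto
    from LIMSEQ_subseq_LIMSEQ[OF LIMSEQ_Suc[OF this] mono]
    have lim: "(\<lambda>n. exp (- 1 :: real) ^ Suc (2 * n)) \<longlonglongrightarrow> 0"
      by (simp only: o_def)
    have "exp (real (2 * n + 1) * (root (2 * n + 1) x - 1)) = exp (- 1) ^ Suc (2 * n)" for n
      using True exp_of_nat_mult[of "2 * n + 1" "- 1 :: real"] by simp
    then show ?thesis
      using lim by (simp only: True)
  next
    case False
    then have x: "x > 0" using assms by simp
    \<comment> \<open>With \<open>h n\<close> the inverse of the degree, the exponent is the
      difference quotient at 0 of \<open>exp (ln x * t)\<close>, whose derivative there is
      \<open>ln x\<close>.\<close>
    define h where "h n = 1 / real (2 * n + 1)" for n
    have "((\<lambda>t. exp (ln x * t)) has_field_derivative ln x) (at 0)"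
      by (auto intro!: derivative_eq_intros)
    then have deriv: "((\<lambda>t. (exp (ln x * t) - 1) / t) \<longlongrightarrow> ln x) (at 0)"
      by (simp add: DERIV_def)
    have "h \<longlonglongrightarrow> 0"
      using LIMSEQ_subseq_LIMSEQ[OF LIMSEQ_inverse_real_of_nat mono]
      by (simp add: h_def[abs_def] o_def divide_inverse add.commute)
    then have "filterlim h (at 0) sequentially"
      by (rule filterlim_atI) (simp add: h_def)
    from tendsto_exp[OF filterlim_compose[OF deriv this]]
    have "(\<lambda>n. exp ((exp (ln x * h n) - 1) / h n)) \<longlonglongrightarrow> x"
      using x by simp
    moreover have "exp (ln x * h n) = root (2 * n + 1) x" for n
      using x by (simp add: h_def root_powr_inverse powr_def mult.commute)
    ultimately show ?thesis
      by (simp add: h_def mult.commute)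
  qed
qed

lemma infinitely_divisible_imp_L_divisible:
  assumes pauli: "pauli_channel E" and inf: "infinitely_divisible E"
  shows "L_divisible E"
proof -
  obtain l where E: "E = pdiag l"
    using pauli by (rule pauli_channel_eq_pdiag)
  have E_channel: "qubit_channel E"
    using inf by (simp add: infinitely_divisible_def)
  have root: "\<exists>X. qubit_channel X \<and> mpow (bloch X) n = dmat l" if n: "n > 0" for n
  proof -
    obtain X where X: "qubit_channel X" "blinfun_apply E = blinfun_apply X ^^ n"
      using inf n unfolding infinitely_divisible_def by blast
    then have "mpow (bloch X) n = dmat l"
      by (intro mpow_bloch_eq_dmat) (simp_all add: E pdiag_apply flip: X(2))
    then show ?thesis using X(1) by blast
  qed
  have "mpow (bloch E) 1 = dmat l"
    using E_channel by (intro mpow_bloch_eq_dmat) (simp_all add: E pdiag_apply)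
  then have bE: "bloch E = dmat l" by simp
  have le1: "\<bar>l $ k\<bar> \<le> 1" for k
    using bloch_minors(3)[OF E_channel, of 2 3 1] bloch_minors(3)[OF E_channel, of 3 1 2]
      bloch_minors(3)[OF E_channel, of 1 2 3] exhaust_3[of k]
    by (auto simp: bE)
  \<comment> \<open>The square root is used only for the signs of the eigenvalues; the inequalities
    for their moduli come from odd roots.\<close>
  obtain S where "mpow (bloch S) 2 = dmat l"
    using root[of 2] by auto
  note sign = square_root_eigenvalues[OF this]
  have nonneg: "l $ k \<ge> 0" if "i \<noteq> j" "j \<noteq> k" "i \<noteq> k" "l $ k \<noteq> l $ i" "l $ k \<noteq> l $ j" for i j k
  proof -
    show ?thesis
      using sign that exhaust_3[of i] exhaust_3[of j] exhaust_3[of k]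
      unfolding cyclic_def by auto
  qed
  define N where "N n = 2 * n + 1" for n :: nat
  define r where "r n = (\<chi> k. root (N n) \<bar>l $ k\<bar>)" for n
  have triangle: "r n $ i + r n $ j \<le> 1 + r n $ k" if "i \<noteq> j" "j \<noteq> k" "i \<noteq> k" for n i j k
  proof -
    obtain X where X: "qubit_channel X" "mpow (bloch X) (N n) = dmat l"
      using root[of "N n"] by (auto simp: N_def)
    show ?thesis
      unfolding r_def vec_lambda_beta
      by (rule root_eigenvalue_triangle[OF X _ that le1 nonneg[OF that]]) (auto simp: N_def)
  qed
  have weight: "pauli_weight (r n) i \<ge> 0" if "i < 4" for n i
  proof -
    have "r n $ k \<ge> 0" for k by (simp add: r_def N_def)
    \<comment> \<open>The first weight is nonnegative because the roots are; the other three are the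
      triangle inequalities.\<close>
    from this[of 1] this[of 2] this[of 3] triangle[of 1 2 3 n] triangle[of 2 3 1 n] triangle[of 3 1 2 n]
    have "pauli_weight (r n) 0 \<ge> 0" "pauli_weight (r n) 1 \<ge> 0" "pauli_weight (r n) 2 \<ge> 0" "pauli_weight (r n) 3 \<ge> 0"
      unfolding pauli_weight_nth by auto
    moreover have "i = 0 \<or> i = 1 \<or> i = 2 \<or> i = 3" using that by auto
    ultimately show ?thesis by blast
  qed
  have gen: "lindblad_generator (pauli_generator (real (N n)) (r n) H)" if "dagger H = H" for n H
    using weight that by (intro lindblad_pauli_generator) auto
  have lim: "(\<lambda>n. exp (real (N n) * (r n $ k - 1))) \<longlonglongrightarrow> \<bar>l $ k\<bar>" for k
    using exp_root_tendsto[of "\<bar>l $ k\<bar>"] by (simp add: r_def N_def)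
  let ?S = "{E'. qubit_channel E' \<and> bij (blinfun_apply E') \<and> (\<exists>L. lindblad_generator L \<and> E' = superop_exp L)}"
  \<comment> \<open>Nonzero eigenvalues \<open>m n $ k\<close> make the approximating channels
    bijective, as the definition of L-divisibility demands.\<close>
  have approx: "E \<in> closure ?S"
    if L: "\<And>n. lindblad_generator (L n)" and m: "\<And>n. superop_exp (L n) = pdiag (m n)"
      "\<And>n k. m n $ k \<noteq> 0" "\<And>k. (\<lambda>n. m n $ k) \<longlonglongrightarrow> l $ k" for L m
  proof -
    have "pdiag (m n) \<in> ?S" for n
      using qubit_channel_lindblad_exp[OF L, of n] bij_pdiag[OF m(2), of n] L m(1) by force
    moreover have "(\<lambda>n. pdiag (m n)) \<longlonglongrightarrow> E"
      unfolding E by (rule tendsto_pdiag) (rule m(3))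
    ultimately show ?thesis
      unfolding closure_sequential by (intro exI[of _ "\<lambda>n. pdiag (m n)"] conjI allI)
  qed
  have "E \<in> closure ?S"
    using sign
  proof
    assume "\<forall>i. l $ i \<ge> 0"
    moreover have "dagger (0 :: complex^2^2) = 0" by (simp add: qubit_eq_iff)
    ultimately show ?thesis
      using lim
      by (intro approx[of "\<lambda>n. pauli_generator (real (N n)) (r n) 0"
            "\<lambda>n. \<chi> k. exp (real (N n) * (r n $ k - 1))"] gen
          superop_exp_pauli_generator) auto
  next
    assume "\<exists>i j k. cyclic i j k \<and> l $ i = l $ j \<and> l $ i < 0 \<and> l $ k \<ge> 0"
    then obtain i j k where ijk: "cyclic i j k" "l $ i = l $ j" "l $ i < 0" "l $ k \<ge> 0"
      by blast
    have herm: "dagger ((pi / 2) *\<^sub>R sg k) = (pi / 2) *\<^sub>R sg k"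
      using exhaust_3[of k] by (auto simp: qubit_eq_iff sg_nth)
    \<comment> \<open>The dissipative part reaches only the moduli; the rotation about axis
      \<open>k\<close> negates the other two, exactly the negative pair.\<close>
    have "(\<lambda>n. (if m = k then 1 else - 1) * exp (real (N n) * (r n $ m - 1))) \<longlonglongrightarrow> l $ m" for m
    proof -
      have "m = i \<or> m = j \<or> m = k"
        using ijk(1) exhaust_3[of m] by (auto simp: cyclic_def)
      then have "(if m = k then 1 else - 1) * \<bar>l $ m\<bar> = l $ m"
        using ijk by auto
      then show ?thesis
        using tendsto_mult_left[OF lim[of m], of "if m = k then 1 else - 1"] by simp
    qed
    moreover have "r n $ i = r n $ j" for n
      using ijk by (simp add: r_def)
    ultimately show ?thesis
      by (intro approx[of "\<lambda>n. pauli_generator (real (N n)) (r n) ((pi / 2) *\<^sub>R sg k)"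
            "\<lambda>n. \<chi> m. (if m = k then 1 else - 1) * exp (real (N n) * (r n $ m - 1))"] gen herm
          superop_exp_pauli_generator_rotated[OF _ ijk(1)]) auto
  qed
  then show ?thesis
    using E_channel by (simp add: L_divisible_def)
qed

theorem theorem19:
  "{E. pauli_channel E \<and> L_divisible E} = {E. pauli_channel E \<and> infinitely_divisible E}"
  using L_divisible_imp_infinitely_divisible infinitely_divisible_imp_L_divisible by blast

end
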